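(* Let $G = F_m\rtimes F_n$ with $m,n\ge 2$, where $F_j$ denotes the free group of rank $j$. If $H^1(G;\mathbb{R})$ has rank $\ge n+1$, then $G$ is incoherent.
   Context: A group is coherent if every finitely generated subgroup is finitely presented, and incoherent otherwise. Rank of $H^1(G;\mathbb{R})$ means its dimension over $\mathbb{R}$. *)

theory Defs
  imports
    "HOL-Algebra.AbelCoset"
    "HOL-Algebra.Bij"
    "HOL-Algebra.Generated_Groups"
    "Jordan_Normal_Form.VS_Connect"
begin

section \<open>Free groups\<close>

text \<open>
  The free group on \<^term>\<open>X\<close> is realised on reduced words.  A letter \<open>(x, True)\<close> stands for
  the generator \<^term>\<open>x\<close> and \<open>(x, False)\<close> for its inverse.
\<close>

definition inv_letter :: "'x \<times> bool \<Rightarrow> 'x \<times> bool" where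
  "inv_letter a = (fst a, \<not> snd a)"

definition reduced :: "('x \<times> bool) list \<Rightarrow> bool" where
  "reduced w \<longleftrightarrow> successively (\<lambda>a b. b \<noteq> inv_letter a) w"

fun cons_cancel :: "'x \<times> bool \<Rightarrow> ('x \<times> bool) list \<Rightarrow> ('x \<times> bool) list" where
  "cons_cancel a [] = [a]"
| "cons_cancel a (b # w) = (if b = inv_letter a then w else a # b # w)"

definition free_group :: "'x set \<Rightarrow> ('x \<times> bool) list monoid" where
  "free_group X =
    \<lparr>carrier = {w. reduced w \<and> fst ` set w \<subseteq> X},
     mult = (\<lambda>u v. foldr cons_cancel u v),
     one = []\<rparr>"

abbreviation free_group_rank :: "nat \<Rightarrow> (nat \<times> bool) list monoid" where
  "free_group_rank j \<equiv> free_group {..<j}"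

lemma inv_letter_inv_letter [simp]: "inv_letter (inv_letter a) = a"
  by (simp add: inv_letter_def)

lemma fst_inv_letter [simp]: "fst (inv_letter a) = fst a"
  by (simp add: inv_letter_def)

lemma inv_letter_neq [simp]: "inv_letter a \<noteq> a" "a \<noteq> inv_letter a"
  by (auto simp: inv_letter_def prod_eq_iff)

lemma reduced_Nil [simp]: "reduced []"
  by (simp add: reduced_def)

lemma reduced_Cons: "reduced (a # w) \<longleftrightarrow> reduced w \<and> (w = [] \<or> hd w \<noteq> inv_letter a)"
  by (auto simp: reduced_def successively_Cons)

lemma reduced_cons_cancel: "reduced w \<Longrightarrow> reduced (cons_cancel a w)"
  by (cases w) (auto simp: reduced_Cons)

lemma reduced_foldr_cons_cancel: "reduced v \<Longrightarrow> reduced (foldr cons_cancel u v)"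
  by (induction u) (auto intro: reduced_cons_cancel)

lemma set_cons_cancel: "set (cons_cancel a w) \<subseteq> insert a (set w)"
  by (cases w) auto

lemma set_foldr_cons_cancel: "set (foldr cons_cancel u v) \<subseteq> set u \<union> set v"
  by (induction u) (use set_cons_cancel in fastforce)+

lemma cons_cancel_inverse: "reduced w \<Longrightarrow> cons_cancel a (cons_cancel (inv_letter a) w) = w"
  by (cases w rule: remdups_adj.cases) (auto simp: reduced_Cons)

lemma foldr_cons_cancel_cons_cancel:
  assumes "reduced u" "reduced w"
  shows "foldr cons_cancel (cons_cancel a u) w = cons_cancel a (foldr cons_cancel u w)"
proof (cases u)
  case (Cons b v)
  show ?thesis
  proof (cases "b = inv_letter a")
    case True
    then show ?thesis
      using Cons assms(2) by (simp add: cons_cancel_inverse reduced_foldr_cons_cancel)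
  qed (simp add: Cons)
qed simp

lemma foldr_cons_cancel_assoc:
  assumes "reduced v" "reduced w"
  shows "foldr cons_cancel (foldr cons_cancel u v) w = foldr cons_cancel u (foldr cons_cancel v w)"
  using assms
  by (induction u) (auto simp: foldr_cons_cancel_cons_cancel reduced_foldr_cons_cancel)

lemma foldr_cons_cancel_Nil: "reduced w \<Longrightarrow> foldr cons_cancel w [] = w"
proof (induction w)
  case (Cons a w)
  then show ?case by (cases w) (auto simp: reduced_Cons)
qed simp

lemma foldr_cons_cancel_rev:
  "reduced v \<Longrightarrow> foldr cons_cancel (rev (map inv_letter w)) (foldr cons_cancel w v) = v"
proof (induction w arbitrary: v)
  case (Cons a w)
  then show ?case
    using cons_cancel_inverse[of "foldr cons_cancel w v" "inv_letter a"]
    by (simp add: reduced_foldr_cons_cancel)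
qed simp

lemma reduced_rev: "reduced w \<Longrightarrow> reduced (rev (map inv_letter w))"
  unfolding reduced_def
  by (simp add: successively_map) (erule successively_mono; metis inv_letter_inv_letter)

lemma group_free_group: "group (free_group X)"
proof (rule groupI)
  fix u v assume "u \<in> carrier (free_group X)" "v \<in> carrier (free_group X)"
  then show "u \<otimes>\<^bsub>free_group X\<^esub> v \<in> carrier (free_group X)"
    using set_foldr_cons_cancel[of u v]
    by (fastforce simp: free_group_def reduced_foldr_cons_cancel)
next
  fix u assume u: "u \<in> carrier (free_group X)"
  then have "rev (map inv_letter u) \<in> carrier (free_group X)"
    by (auto simp: free_group_def reduced_rev)
  moreover have "rev (map inv_letter u) \<otimes>\<^bsub>free_group X\<^esub> u = \<one>\<^bsub>free_group X\<^esub>"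
    using u foldr_cons_cancel_rev[of "[]" u]
    by (auto simp: free_group_def foldr_cons_cancel_Nil)
  ultimately show "\<exists>v\<in>carrier (free_group X). v \<otimes>\<^bsub>free_group X\<^esub> u = \<one>\<^bsub>free_group X\<^esub>"
    by blast
qed (auto simp: free_group_def foldr_cons_cancel_assoc foldr_cons_cancel_Nil)

section \<open>Semidirect products\<close>

definition semidirect_product ::
  "('a, 'c) monoid_scheme \<Rightarrow> ('b, 'd) monoid_scheme \<Rightarrow> ('b \<Rightarrow> 'a \<Rightarrow> 'a) \<Rightarrow> ('a \<times> 'b) monoid"
where
  "semidirect_product N H \<phi> =
    \<lparr>carrier = carrier N \<times> carrier H,
     mult = (\<lambda>(a, x) (b, y). (a \<otimes>\<^bsub>N\<^esub> \<phi> x b, x \<otimes>\<^bsub>H\<^esub> y)),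
     one = (\<one>\<^bsub>N\<^esub>, \<one>\<^bsub>H\<^esub>)\<rparr>"

lemma group_semidirect_product:
  assumes "group N" "group H" and \<phi>: "\<phi> \<in> hom H (AutoGroup N)"
  shows "group (semidirect_product N H \<phi>)"
proof -
  interpret N: group N by fact
  interpret H: group H by fact
  interpret A: group "AutoGroup N" by (rule N.AutoGroup)
  interpret \<phi>: group_hom H "AutoGroup N" \<phi>
    by (rule group_hom.intro) (auto simp: group_hom_axioms_def \<phi> A.is_group)
  have aut: "\<phi> x \<in> auto N" if "x \<in> carrier H" for x
    using \<phi>.hom_closed[OF that] by (simp add: AutoGroup_def)
  have hom: "\<phi> x \<in> hom N N" if "x \<in> carrier H" for x
    using aut[OF that] by (simp add: auto_def)
  have closed: "\<phi> x a \<in> carrier N" if "x \<in> carrier H" "a \<in> carrier N" for x a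
    using hom[OF that(1)] that(2) by (auto simp: hom_def)
  have mult: "\<phi> x (a \<otimes>\<^bsub>N\<^esub> b) = \<phi> x a \<otimes>\<^bsub>N\<^esub> \<phi> x b"
    if "x \<in> carrier H" "a \<in> carrier N" "b \<in> carrier N" for x a b
    using hom[OF that(1)] that by (auto simp: hom_def)
  have one: "\<phi> x \<one>\<^bsub>N\<^esub> = \<one>\<^bsub>N\<^esub>" if "x \<in> carrier H" for x
    using hom_one[OF hom[OF that]] by (simp add: N.is_group)
  have comp: "\<phi> (x \<otimes>\<^bsub>H\<^esub> y) a = \<phi> x (\<phi> y a)"
    if "x \<in> carrier H" "y \<in> carrier H" "a \<in> carrier N" for x y a
    using \<phi>.hom_mult[OF that(1,2)] aut[OF that(1)] aut[OF that(2)] that(3)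
    by (simp add: AutoGroup_def BijGroup_def auto_def compose_def)
  have unit: "\<phi> \<one>\<^bsub>H\<^esub> a = a" if "a \<in> carrier N" for a
    using \<phi>.hom_one that by (simp add: AutoGroup_def BijGroup_def)
  show ?thesis
  proof (rule groupI)
    fix p assume p: "p \<in> carrier (semidirect_product N H \<phi>)"
    obtain a x where ax: "p = (a, x)" "a \<in> carrier N" "x \<in> carrier H"
      using p by (auto simp: semidirect_product_def)
    let ?q = "(\<phi> (inv\<^bsub>H\<^esub> x) (inv\<^bsub>N\<^esub> a), inv\<^bsub>H\<^esub> x)"
    have "?q \<in> carrier (semidirect_product N H \<phi>)"
      using ax by (simp add: semidirect_product_def closed del: \<phi>.hom_inv)
    moreover have "?q \<otimes>\<^bsub>semidirect_product N H \<phi>\<^esub> p = \<one>\<^bsub>semidirect_product N H \<phi>\<^esub>"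
      using ax by (simp add: semidirect_product_def mult[symmetric] one del: \<phi>.hom_inv)
    ultimately show "\<exists>q\<in>carrier (semidirect_product N H \<phi>).
        q \<otimes>\<^bsub>semidirect_product N H \<phi>\<^esub> p = \<one>\<^bsub>semidirect_product N H \<phi>\<^esub>"
      by blast
  qed (auto simp: semidirect_product_def closed mult comp unit N.m_assoc H.m_assoc
      simp del: \<phi>.hom_mult \<phi>.hom_one)
qed

section \<open>Finite presentability and coherence\<close>

definition finitely_generated :: "('a, 'b) monoid_scheme \<Rightarrow> bool" where
  "finitely_generated G \<longleftrightarrow> (\<exists>S. finite S \<and> S \<subseteq> carrier G \<and> generate G S = carrier G)"

definition normal_closure :: "('a, 'b) monoid_scheme \<Rightarrow> 'a set \<Rightarrow> 'a set" where
  "normal_closure G R = \<Inter>{N. N \<lhd> G \<and> R \<subseteq> N}"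

definition finitely_presented :: "('a, 'b) monoid_scheme \<Rightarrow> bool" where
  "finitely_presented G \<longleftrightarrow>
    (\<exists>k R. finite R \<and> R \<subseteq> carrier (free_group_rank k) \<and>
       free_group_rank k Mod normal_closure (free_group_rank k) R \<cong> G)"

definition coherent :: "('a, 'b) monoid_scheme \<Rightarrow> bool" where
  "coherent G \<longleftrightarrow>
    (\<forall>H. subgroup H G \<longrightarrow> finitely_generated (G\<lparr>carrier := H\<rparr>) \<longrightarrow>
       finitely_presented (G\<lparr>carrier := H\<rparr>))"

abbreviation incoherent :: "('a, 'b) monoid_scheme \<Rightarrow> bool" where
  "incoherent G \<equiv> \<not> coherent G"

section \<open>Group cohomology with trivial real coefficients\<close>

text \<open>
  Inhomogeneous cochains \<open>G\<^sup>n \<rightarrow> \<real>\<close>: an \<^term>\<open>n\<close>-tuple of group elements is a list of length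
  \<^term>\<open>n\<close>, and a cochain vanishes on all lists that are not such tuples, so that distinct
  elements of the carrier are distinct functions on \<open>G\<^sup>n\<close>.
\<close>

definition tuples :: "('a, 'b) monoid_scheme \<Rightarrow> nat \<Rightarrow> 'a list set" where
  "tuples G n = {gs. length gs = n \<and> set gs \<subseteq> carrier G}"

definition cochains :: "('a, 'b) monoid_scheme \<Rightarrow> nat \<Rightarrow> (real, 'a list \<Rightarrow> real) module" where
  "cochains G n =
    \<lparr>carrier = {f. \<forall>gs. gs \<notin> tuples G n \<longrightarrow> f gs = 0},
     mult = undefined, one = undefined,
     zero = (\<lambda>_. 0),
     add = (\<lambda>f h gs. f gs + h gs),
     smult = (\<lambda>r f gs. r * f gs)\<rparr>"

definition merge :: "('a, 'b) monoid_scheme \<Rightarrow> nat \<Rightarrow> 'a list \<Rightarrow> 'a list" where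
  "merge G i gs = take i gs @ (gs ! i \<otimes>\<^bsub>G\<^esub> gs ! Suc i) # drop (Suc (Suc i)) gs"

text \<open>
  The bar differential
  \<open>(\<delta>f)(g\<^sub>0,\<dots>,g\<^sub>n) = f(g\<^sub>1,\<dots>,g\<^sub>n) + (\<Sum>i<n. (-1)\<^sup>i\<^sup>+\<^sup>1 f(\<dots>,g\<^sub>ig\<^sub>i\<^sub>+\<^sub>1,\<dots>)) + (-1)\<^sup>n\<^sup>+\<^sup>1 f(g\<^sub>0,\<dots>,g\<^sub>n\<^sub>-\<^sub>1)\<close>;
  since the action on the coefficients is trivial, the first summand carries no factor \<open>g\<^sub>0\<close>.
\<close>

definition coboundary ::
  "('a, 'b) monoid_scheme \<Rightarrow> nat \<Rightarrow> ('a list \<Rightarrow> real) \<Rightarrow> 'a list \<Rightarrow> real"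
where
  "coboundary G n f =
    (\<lambda>gs. if gs \<in> tuples G (Suc n)
       then f (tl gs) + (\<Sum>i<n. (- 1) ^ Suc i * f (merge G i gs)) + (- 1) ^ Suc n * f (butlast gs)
       else 0)"

definition cocycles :: "('a, 'b) monoid_scheme \<Rightarrow> nat \<Rightarrow> ('a list \<Rightarrow> real) set" where
  "cocycles G n = {f \<in> carrier (cochains G n). coboundary G n f = (\<lambda>_. 0)}"

fun coboundaries :: "('a, 'b) monoid_scheme \<Rightarrow> nat \<Rightarrow> ('a list \<Rightarrow> real) set" where
  "coboundaries G 0 = {\<lambda>_. 0}"
| "coboundaries G (Suc n) = coboundary G n ` carrier (cochains G n)"

text \<open>
  The quotient of a module by a submodule, on cosets.  The ring multiplication and unit in the
  record type of modules are irrelevant.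
\<close>

definition quotient_module ::
  "('r, 'v, 'c) module_scheme \<Rightarrow> 'v set \<Rightarrow> ('r, 'v set) module"
where
  "quotient_module V W =
    \<lparr>carrier = a_rcosets\<^bsub>V\<^esub> W,
     mult = undefined, one = undefined,
     zero = W,
     add = set_add V,
     smult = (\<lambda>r C. \<Union>v\<in>C. W +>\<^bsub>V\<^esub> (r \<odot>\<^bsub>V\<^esub> v))\<rparr>"

definition cohomology ::
  "('a, 'b) monoid_scheme \<Rightarrow> nat \<Rightarrow> (real, ('a list \<Rightarrow> real) set) module"
where
  "cohomology G n =
    quotient_module (cochains G n\<lparr>carrier := cocycles G n\<rparr>) (coboundaries G n)"

lemma module_quotient_module:
  assumes "submodule K W V"
  shows "module K (quotient_module V W)"
proof -
  interpret S: submodule K W V by fact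
  interpret Module.module K V by (rule S.module)
  interpret W: abelian_subgroup W V
  proof (rule abelian_subgroupI3)
    have "\<ominus>\<^bsub>V\<^esub> v \<in> W" if v: "v \<in> W" for v
    proof -
      have "v \<in> carrier V" using v S.subset by blast
      then have "\<ominus>\<^bsub>V\<^esub> v = (\<ominus>\<^bsub>K\<^esub> \<one>\<^bsub>K\<^esub>) \<odot>\<^bsub>V\<^esub> v" by (simp add: smult_l_minus)
      then show ?thesis using v by simp
    qed
    then have "Module.submodule W K V"
      by (intro submoduleI) (use S.subset in auto)
    then show "additive_subgroup W V"
      by (simp add: additive_subgroup_def Module.submodule_def)
  qed (rule abelian_group_axioms)
  let ?Q = "quotient_module V W"
  note coset_add = W.a_rcos_sum
  have carr: "carrier ?Q = (\<lambda>v. W +>\<^bsub>V\<^esub> v) ` carrier V"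
    by (auto simp: quotient_module_def A_RCOSETS_def')
  have eqI: "W +>\<^bsub>V\<^esub> u = W +>\<^bsub>V\<^esub> v" if "u \<in> W +>\<^bsub>V\<^esub> v" "v \<in> carrier V" for u v
    using W.a_repr_independence'[OF that] by simp
  have smult: "r \<odot>\<^bsub>?Q\<^esub> (W +>\<^bsub>V\<^esub> v) = W +>\<^bsub>V\<^esub> (r \<odot>\<^bsub>V\<^esub> v)"
    if r: "r \<in> carrier K" and v: "v \<in> carrier V" for r v
  proof -
    have const: "W +>\<^bsub>V\<^esub> (r \<odot>\<^bsub>V\<^esub> u) = W +>\<^bsub>V\<^esub> (r \<odot>\<^bsub>V\<^esub> v)" if u: "u \<in> W +>\<^bsub>V\<^esub> v" for u
    proof (rule eqI)
      obtain w where w: "w \<in> W" "u = w \<oplus>\<^bsub>V\<^esub> v" using u by (auto simp: a_r_coset_def')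
      have "r \<odot>\<^bsub>V\<^esub> u = r \<odot>\<^bsub>V\<^esub> w \<oplus>\<^bsub>V\<^esub> r \<odot>\<^bsub>V\<^esub> v" "r \<odot>\<^bsub>V\<^esub> w \<in> W"
        using w r v S.subset by (auto simp: smult_r_distr)
      then show "r \<odot>\<^bsub>V\<^esub> u \<in> W +>\<^bsub>V\<^esub> (r \<odot>\<^bsub>V\<^esub> v)" by (auto simp: a_r_coset_def')
    qed (use r v in auto)
    have ne: "W +>\<^bsub>V\<^esub> v \<noteq> {}" using W.a_rcos_self[OF v] by blast
    have "r \<odot>\<^bsub>?Q\<^esub> (W +>\<^bsub>V\<^esub> v) = (\<Union>u\<in>W +>\<^bsub>V\<^esub> v. W +>\<^bsub>V\<^esub> (r \<odot>\<^bsub>V\<^esub> u))"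
      by (simp add: quotient_module_def)
    also have "\<dots> = (\<Union>u\<in>W +>\<^bsub>V\<^esub> v. W +>\<^bsub>V\<^esub> (r \<odot>\<^bsub>V\<^esub> v))"
      by (rule SUP_cong[OF refl]) (rule const)
    also have "\<dots> = W +>\<^bsub>V\<^esub> (r \<odot>\<^bsub>V\<^esub> v)"
      by (rule UN_constant[THEN trans]) (simp add: ne)
    finally show ?thesis .
  qed
  have add: "(W +>\<^bsub>V\<^esub> u) \<oplus>\<^bsub>?Q\<^esub> (W +>\<^bsub>V\<^esub> v) = W +>\<^bsub>V\<^esub> (u \<oplus>\<^bsub>V\<^esub> v)"
    if "u \<in> carrier V" "v \<in> carrier V" for u v
    using coset_add[OF that] by (simp add: quotient_module_def)
  have zero: "\<zero>\<^bsub>?Q\<^esub> = W +>\<^bsub>V\<^esub> \<zero>\<^bsub>V\<^esub>"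
    using S.subset by (simp add: quotient_module_def)
  show ?thesis
  proof (rule moduleI)
    show "abelian_group ?Q"
    proof (rule abelian_groupI)
      fix x assume "x \<in> carrier ?Q"
      then obtain v where v: "v \<in> carrier V" "x = W +>\<^bsub>V\<^esub> v" by (auto simp: carr)
      then have "W +>\<^bsub>V\<^esub> (\<ominus>\<^bsub>V\<^esub> v) \<in> carrier ?Q" "(W +>\<^bsub>V\<^esub> (\<ominus>\<^bsub>V\<^esub> v)) \<oplus>\<^bsub>?Q\<^esub> x = \<zero>\<^bsub>?Q\<^esub>"
        by (auto simp: carr add zero l_neg)
      then show "\<exists>y\<in>carrier ?Q. y \<oplus>\<^bsub>?Q\<^esub> x = \<zero>\<^bsub>?Q\<^esub>" by blast
    qed (auto simp: carr add zero M.a_ac)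
  qed (auto simp: carr add smult smult_l_distr smult_r_distr smult_assoc1 cring_axioms)
qed

lemma vectorspace_cochains: "vectorspace (class_ring :: real ring) (cochains G n)"
proof -
  have "\<exists>y\<in>carrier (cochains G n). y \<oplus>\<^bsub>cochains G n\<^esub> f = \<zero>\<^bsub>cochains G n\<^esub>"
    if "f \<in> carrier (cochains G n)" for f
    using that by (intro bexI[of _ "\<lambda>gs. - f gs"]) (auto simp: cochains_def)
  then have "module (class_ring :: real ring) (cochains G n)"
    by (intro moduleI abelian_groupI class_cring.cring_axioms)
      (auto simp: cochains_def fun_eq_iff algebra_simps)
  then show ?thesis
    by (simp add: vectorspace_def class_field.field_axioms)
qed

lemma coboundary_add:
  "coboundary G n (\<lambda>gs. f gs + h gs) = (\<lambda>gs. coboundary G n f gs + coboundary G n h gs)"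
  by (auto simp: coboundary_def fun_eq_iff algebra_simps sum.distrib[symmetric] simp flip: sum_negf intro!: sum.cong)

lemma coboundary_smult:
  "coboundary G n (\<lambda>gs. r * f gs) = (\<lambda>gs. r * coboundary G n f gs)"
  by (auto simp: coboundary_def fun_eq_iff algebra_simps sum_distrib_left)

lemma submodule_cocycles:
  "submodule (class_ring :: real ring) (cocycles G n) (cochains G n)"
proof -
  interpret vectorspace "class_ring :: real ring" "cochains G n"
    by (rule vectorspace_cochains)
  show ?thesis
    by unfold_locales
      (auto simp: cocycles_def cochains_def coboundary_add coboundary_smult, simp add: coboundary_def fun_eq_iff)
qed

lemma coboundaries_1: "coboundaries G 1 = {\<lambda>_. 0}"
proof -
  have "coboundary G 0 f = (\<lambda>_. 0)" if "f \<in> carrier (cochains G 0)" for f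
  proof
    fix gs show "coboundary G 0 f gs = 0"
      by (cases gs) (auto simp: coboundary_def tuples_def)
  qed
  moreover have "(\<lambda>_. 0) \<in> carrier (cochains G 0)" by (simp add: cochains_def)
  ultimately show ?thesis by (auto simp: image_iff)
qed

lemma cocycles_1:
  assumes "f \<in> carrier (cochains G 1)"
  shows "f \<in> cocycles G 1 \<longleftrightarrow>
    (\<forall>g\<in>carrier G. \<forall>h\<in>carrier G. f [g \<otimes>\<^bsub>G\<^esub> h] = f [g] + f [h])"
    (is "_ \<longleftrightarrow> ?rhs")
proof -
  have "f \<in> cocycles G 1 \<longleftrightarrow> (\<forall>gs. coboundary G 1 f gs = 0)"
    using assms by (auto simp: cocycles_def fun_eq_iff)
  also have "\<dots> \<longleftrightarrow> (\<forall>g h. coboundary G 1 f [g, h] = 0)"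
  proof safe
    fix gs assume *: "\<forall>g h. coboundary G 1 f [g, h] = 0"
    show "coboundary G 1 f gs = 0"
    proof (cases "gs \<in> tuples G 2")
      case True
      then obtain g h where "gs = [g, h]"
        by (auto simp: tuples_def numeral_2_eq_2 length_Suc_conv)
      then show ?thesis using * by simp
    qed (simp add: coboundary_def numeral_2_eq_2)
  qed simp
  also have "\<dots> \<longleftrightarrow> (\<forall>g\<in>carrier G. \<forall>h\<in>carrier G. f [h] - f [g \<otimes>\<^bsub>G\<^esub> h] + f [g] = 0)"
    by (auto simp: coboundary_def tuples_def merge_def)
  also have "\<dots> \<longleftrightarrow> ?rhs"
    by (intro ball_cong refl) linarith
  finally show ?thesis .
qed

lemma vectorspace_cohomology_1:
  "vectorspace (class_ring :: real ring) (cohomology G 1)"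
proof -
  let ?R = "class_ring :: real ring"
  interpret Z: submodule ?R "cocycles G 1" "cochains G 1" by (rule submodule_cocycles)
  interpret C: vectorspace ?R "cochains G 1" by (rule vectorspace_cochains)
  let ?Z = "cochains G 1\<lparr>carrier := cocycles G 1\<rparr>"
  have mod: "module ?R ?Z"
    using C.submodule_is_module[OF submodule_cocycles] by simp
  have "submodule ?R (coboundaries G 1) ?Z"
    unfolding coboundaries_1
    by (rule submodule.intro[OF mod]) (use Z.zero_closed in \<open>auto simp: cochains_def\<close>)
  then show ?thesis
    by (simp add: cohomology_def vectorspace_def module_quotient_module class_field.field_axioms)
qed

text \<open>
  The dimension of the real vector space \<open>H\<^sup>1(G;\<real>)\<close>.  It is meaningful when that space is
  finite-dimensional, which holds for every finitely generated \<^term>\<open>G\<close>.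
\<close>

definition rank_H1 :: "('a, 'b) monoid_scheme \<Rightarrow> nat" where
  "rank_H1 G = vectorspace.dim (class_ring :: real ring) (cohomology G 1)"

end

theory Submission
  imports Defs
begin

text \<open>
  Write \<open>G = F\<^sub>m \<rtimes> F\<^sub>n\<close> with free generators \<open>t\<^sub>0, \<dots>, t\<^sub>n\<^sub>-\<^sub>1\<close> of \<open>F\<^sub>n\<close>.  The classes in \<open>H\<^sup>1(G;\<real>)\<close>
  that vanish on \<open>F\<^sub>m\<close> come from \<open>F\<^sub>n\<close> and form a space of dimension at most \<open>n\<close>, so some class
  is nonzero on \<open>F\<^sub>m\<close>.  Its restriction to \<open>F\<^sub>m\<close> is invariant under \<open>F\<^sub>n\<close>, because conjugation is
  invisible to an additive function.  Composing with a \<open>\<rat>\<close>-linear map \<open>\<real> \<rightarrow> \<rat>\<close> and rescaling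
  turns it into an invariant epimorphism \<open>F\<^sub>m \<rightarrow> \<int>\<close>, called a weight below.  Let \<open>N\<close> be its kernel
  and \<open>a\<close> an element of weight \<open>1\<close>.

  Replace \<open>t\<^sub>i\<close> by \<open>s\<^sub>i = a\<^sup>P t\<^sub>i\<close> for a large integer \<open>P\<close>.  The \<open>s\<^sub>i\<close> generate a free complement of
  \<open>F\<^sub>m\<close>, and with \<open>N\<close> they generate a subgroup \<open>K = N \<rtimes> \<langle>s\<^sub>0, \<dots>, s\<^sub>n\<^sub>-\<^sub>1\<rangle>\<close>, the kernel of the
  homomorphism \<open>G \<rightarrow> \<int>\<close> that extends the weight and kills every \<open>s\<^sub>i\<close>.  This \<open>K\<close> is the witness for
  incoherence.  Three facts carry the proof.

  \<^item> \<open>N\<close> is not finitely generated (\<open>weight_kernel_not_finitely_generated\<close>): the prefixes of the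
    words in a finitely generated subgroup of \<open>N\<close> have bounded weight, those of the words in \<open>N\<close> do
    not.

  \<^item> \<open>N\<close> lies in a group generated by \<open>s\<^sub>0\<close> and finitely many elements of \<open>N\<close>
    (\<open>weight_kernel_twisted_generators\<close>), hence \<open>K\<close> is finitely generated.  The Schreier generators
    \<open>a\<^sup>k y a\<^sup>l\<close> of \<open>N\<close>, for letters \<open>y\<close> and with \<open>l\<close> chosen to make the weight zero, are arranged
    along the line of integers \<open>k\<close>.  An automorphism that
    preserves the weight moves them by a bounded amount, whereas conjugation by \<open>a\<^sup>P\<close> shifts them
    by \<open>P\<close>; for large \<open>P\<close>, conjugation by \<open>s\<^sub>0\<close> and its inverse therefore reaches
    further and further in both directions.  This is the openness of the set of fibred
    classes, made explicit near the class of \<open>F\<^sub>m \<rtimes> \<langle>t\<^sub>0\<rangle>\<close> with kernel \<open>F\<^sub>m\<close>.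

  \<^item> An extension \<open>K\<close> of a free group on at least two generators by \<open>N\<close>, with these two properties,
    is not finitely presented (\<open>split_extension_not_finitely_presented\<close>).  The defining
    relations of \<open>K\<close> over \<open>\<langle>N, s\<^sub>0\<rangle>\<close> say how the other \<open>s\<^sub>i\<close> conjugate the
    elements of \<open>N\<close>.  For every finite part of these relations there is a permutation action of the generators that satisfies that
    part and violates another of them.  A finite presentation would make one of these actions an
    action of \<open>K\<close>.
\<close>

section \<open>Free groups\<close>

lemma carrier_free_group: "w \<in> carrier (free_group X) \<longleftrightarrow> reduced w \<and> fst ` set w \<subseteq> X"
  by (simp add: free_group_def)

lemma mult_free_group: "u \<otimes>\<^bsub>free_group X\<^esub> v = foldr cons_cancel u v"
  by (simp add: free_group_def)

lemma one_free_group: "\<one>\<^bsub>free_group X\<^esub> = []"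
  by (simp add: free_group_def)

lemma letter_in_free_group: "i \<in> X \<Longrightarrow> [(i, b)] \<in> carrier (free_group X)"
  by (simp add: carrier_free_group reduced_def)

lemma inv_letter_free_group:
  assumes "i \<in> X"
  shows "inv\<^bsub>free_group X\<^esub> [(i, b)] = [(i, \<not> b)]"
proof -
  interpret group "free_group X" by (rule group_free_group)
  show ?thesis
    by (rule inv_equality)
      (use assms in \<open>auto simp: letter_in_free_group mult_free_group one_free_group inv_letter_def\<close>)
qed

lemma Cons_in_free_group:
  assumes "a # w \<in> carrier (free_group X)"
  shows "fst a \<in> X" "[a] \<in> carrier (free_group X)" "w \<in> carrier (free_group X)"
    and "[a] \<otimes>\<^bsub>free_group X\<^esub> w = a # w"
  using assms by (cases w; auto simp: carrier_free_group mult_free_group reduced_def)+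

text \<open>
  In the inductive step both factors of \<open>a # w\<close> are again reduced words, so that a homomorphism
  can be applied to the product.
\<close>

lemma free_group_induct [consumes 1, case_names one mult]:
  assumes "w \<in> carrier (free_group X)"
    and "P []"
    and "\<And>a w. fst a \<in> X \<Longrightarrow> [a] \<in> carrier (free_group X) \<Longrightarrow> w \<in> carrier (free_group X) \<Longrightarrow>
      a # w \<in> carrier (free_group X) \<Longrightarrow> [a] \<otimes>\<^bsub>free_group X\<^esub> w = a # w \<Longrightarrow> P w \<Longrightarrow> P (a # w)"
  shows "P w"
  using assms(1)
proof (induction w)
  case (Cons a w)
  then show ?case
    using Cons_in_free_group[OF Cons.prems] by (intro assms(3)) auto
qed (rule assms(2))

definition letter_image :: "('g, 'r) monoid_scheme \<Rightarrow> ('x \<Rightarrow> 'g) \<Rightarrow> 'x \<times> bool \<Rightarrow> 'g" where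
  "letter_image G s a = (if snd a then s (fst a) else inv\<^bsub>G\<^esub> s (fst a))"

text \<open>
  \<open>word_image G s\<close> is the homomorphism out of a free group that the universal property attaches to
  the images \<open>s\<close> of the generators.
\<close>

definition word_image :: "('g, 'r) monoid_scheme \<Rightarrow> ('x \<Rightarrow> 'g) \<Rightarrow> ('x \<times> bool) list \<Rightarrow> 'g" where
  "word_image G s w = foldr (\<lambda>a. mult G (letter_image G s a)) w \<one>\<^bsub>G\<^esub>"

lemma word_image_Nil [simp]: "word_image G s [] = \<one>\<^bsub>G\<^esub>"
  and word_image_Cons [simp]:
    "word_image G s (a # w) = letter_image G s a \<otimes>\<^bsub>G\<^esub> word_image G s w"
  by (simp_all add: word_image_def)

context group
begin

lemma inv_mult_cancel:
  assumes "x \<in> carrier G" "y \<in> carrier G"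
  shows "inv x \<otimes> (x \<otimes> y) = y" "x \<otimes> (inv x \<otimes> y) = y"
  using assms by (simp_all flip: m_assoc)

lemma letter_image_closed: "s \<in> X \<rightarrow> carrier G \<Longrightarrow> fst a \<in> X \<Longrightarrow> letter_image G s a \<in> carrier G"
  by (auto simp: letter_image_def)

lemma word_image_closed:
  "s \<in> X \<rightarrow> carrier G \<Longrightarrow> fst ` set w \<subseteq> X \<Longrightarrow> word_image G s w \<in> carrier G"
  by (induction w) (auto simp: letter_image_closed)

lemma word_image_cons_cancel:
  assumes s: "s \<in> X \<rightarrow> carrier G" and "fst a \<in> X" "fst ` set w \<subseteq> X"
  shows "word_image G s (cons_cancel a w) = letter_image G s a \<otimes> word_image G s w"
proof (cases "\<exists>v. w = inv_letter a # v")
  case True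
  then obtain v where v: "w = inv_letter a # v" by blast
  have "letter_image G s a \<otimes> letter_image G s (inv_letter a) = \<one>"
    using assms by (auto simp: letter_image_def inv_letter_def Pi_iff)
  moreover have "letter_image G s a \<in> carrier G" "letter_image G s (inv_letter a) \<in> carrier G"
    "word_image G s v \<in> carrier G"
    using assms v by (auto intro!: letter_image_closed[OF s] word_image_closed[OF s])
  ultimately show ?thesis
    using v by (simp flip: m_assoc)
next
  case False
  then show ?thesis by (cases w) auto
qed

lemma word_image_foldr:
  assumes "s \<in> X \<rightarrow> carrier G" and "fst ` set u \<subseteq> X" "fst ` set v \<subseteq> X"
  shows "word_image G s (foldr cons_cancel u v) = word_image G s u \<otimes> word_image G s v"
  using assms(2)
proof (induction u)
  case Nil
  then show ?case using assms by (auto simp: word_image_closed)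
next
  case (Cons a u)
  have "fst ` set (foldr cons_cancel u v) \<subseteq> X"
    using Cons.prems assms(3) set_foldr_cons_cancel[of u v] by fastforce
  then show ?case
    using Cons assms word_image_cons_cancel[OF assms(1), of a "foldr cons_cancel u v"]
    by (auto simp: m_assoc letter_image_closed[OF assms(1)] word_image_closed[OF assms(1)])
qed

lemma word_image_hom:
  assumes "s \<in> X \<rightarrow> carrier G"
  shows "word_image G s \<in> hom (free_group X) G"
  by (rule homI)
    (simp_all add: carrier_free_group mult_free_group word_image_foldr[OF assms]
      word_image_closed[OF assms])

lemma word_image_letter:
  assumes "s \<in> X \<rightarrow> carrier G" "i \<in> X"
  shows "word_image G s [(i, True)] = s i"
  using assms by (auto simp: letter_image_def Pi_iff)

lemma hom_free_group_eq:
  assumes h: "h \<in> hom (free_group X) G" and h': "h' \<in> hom (free_group X) G"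
    and eq: "\<And>i. i \<in> X \<Longrightarrow> h [(i, True)] = h' [(i, True)]"
    and w: "w \<in> carrier (free_group X)"
  shows "h w = h' w"
proof -
  interpret h: group_hom "free_group X" G h
    using h by (simp add: group_hom_def group_hom_axioms_def group_free_group)
  interpret h': group_hom "free_group X" G h'
    using h' by (simp add: group_hom_def group_hom_axioms_def group_free_group)
  have letter: "h [a] = h' [a]" if "fst a \<in> X" for a
  proof (cases a)
    case (Pair i b)
    then show ?thesis
      using that eq[of i] h.hom_inv[OF letter_in_free_group, of i True]
        h'.hom_inv[OF letter_in_free_group, of i True]
      by (cases b) (auto simp: inv_letter_free_group)
  qed
  show ?thesis
    using w
  proof (induction w rule: free_group_induct)
    case one
    show ?case using h.hom_one h'.hom_one by (simp add: one_free_group)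
  next
    case (mult a w)
    then show ?case
      using h.hom_mult[of "[a]" w] h'.hom_mult[of "[a]" w] letter by simp
  qed
qed

end

section \<open>Weights on free groups\<close>

text \<open>
  A weight is an additive function on words; it is determined by its values \<open>v\<close> on the generators.
  With \<open>v = (\<lambda>_. 1)\<close> it is the total exponent sum.
\<close>

definition letter_weight :: "('x \<Rightarrow> 'a::ab_group_add) \<Rightarrow> 'x \<times> bool \<Rightarrow> 'a" where
  "letter_weight v a = (if snd a then v (fst a) else - v (fst a))"

definition weight :: "('x \<Rightarrow> 'a::ab_group_add) \<Rightarrow> ('x \<times> bool) list \<Rightarrow> 'a" where
  "weight v w = sum_list (map (letter_weight v) w)"

lemma weight_Nil [simp]: "weight v [] = 0"
  and weight_Cons [simp]: "weight v (a # w) = letter_weight v a + weight v w"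
  and weight_append [simp]: "weight v (u @ w) = weight v u + weight v w"
  by (simp_all add: weight_def)

lemma letter_weight_inv_letter [simp]: "letter_weight v (inv_letter a) = - letter_weight v a"
  by (simp add: letter_weight_def inv_letter_def)

lemma weight_cons_cancel [simp]: "weight v (cons_cancel a w) = letter_weight v a + weight v w"
  by (cases w) (auto simp: add.assoc[symmetric])

lemma weight_foldr [simp]: "weight v (foldr cons_cancel u w) = weight v u + weight v w"
  by (induction u) (auto simp: add.assoc)

lemma weight_mult [simp]: "weight v (u \<otimes>\<^bsub>free_group X\<^esub> w) = weight v u + weight v w"
  by (simp add: mult_free_group)

lemma weight_one [simp]: "weight v \<one>\<^bsub>free_group X\<^esub> = 0"
  by (simp add: one_free_group)

lemma weight_inv [simp]:
  assumes "w \<in> carrier (free_group X)"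
  shows "weight v (inv\<^bsub>free_group X\<^esub> w) = - weight v w"
proof -
  interpret group "free_group X" by (rule group_free_group)
  have "weight v (inv\<^bsub>free_group X\<^esub> w \<otimes>\<^bsub>free_group X\<^esub> w) = 0"
    using assms by (simp add: l_inv del: weight_mult)
  then show ?thesis by (simp add: add_eq_0_iff)
qed

lemma weight_int_pow:
  fixes v :: "'x \<Rightarrow> int"
  assumes "a \<in> carrier (free_group X)"
  shows "weight v (a [^]\<^bsub>free_group X\<^esub> (k::int)) = k * weight v a"
proof -
  interpret group "free_group X" by (rule group_free_group)
  have nat: "weight v (a [^]\<^bsub>free_group X\<^esub> (j::nat)) = int j * weight v a" for j
    by (induction j) (simp_all add: algebra_simps)
  show ?thesis
  proof (cases k)
    case (neg j)
    then show ?thesis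
      using assms nat[of "Suc j"]
      by (simp only: neg int_pow_neg_int weight_inv nat_pow_closed mult_minus_left)
  qed (simp add: int_pow_int nat)
qed

lemma additive_eq_weight:
  fixes g :: "('x \<times> bool) list \<Rightarrow> 'a::ab_group_add"
  assumes g: "\<And>u w. u \<in> carrier (free_group X) \<Longrightarrow> w \<in> carrier (free_group X) \<Longrightarrow>
      g (u \<otimes>\<^bsub>free_group X\<^esub> w) = g u + g w"
    and w: "w \<in> carrier (free_group X)"
  shows "g w = weight (\<lambda>i. g [(i, True)]) w"
proof -
  interpret group "free_group X" by (rule group_free_group)
  have one: "g [] = 0"
    using g[OF one_closed one_closed] by (simp add: one_free_group mult_free_group)
  have letter: "g [a] = letter_weight (\<lambda>i. g [(i, True)]) a" if "fst a \<in> X" for a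
  proof (cases a)
    case (Pair i b)
    have "g [(i, True)] + g [(i, False)] = 0"
      using that Pair g[of "[(i, True)]" "[(i, False)]"] one
      by (simp add: letter_in_free_group mult_free_group inv_letter_def)
    then show ?thesis
      using Pair by (cases b) (auto simp: letter_weight_def eq_neg_iff_add_eq_0 add.commute)
  qed
  show ?thesis
    using w
  proof (induction w rule: free_group_induct)
    case (mult a w)
    then show ?case using g[of "[a]" w] letter by simp
  qed (simp add: one)
qed

section \<open>Asymptotic homomorphisms out of finitely presented groups\<close>

lemma (in group) normal_closure_normal:
  assumes "R \<subseteq> carrier G"
  shows "normal_closure G R \<lhd> G"
proof -
  have carrier: "carrier G \<lhd> G"
    by (simp add: normal_inv_iff subgroup_self)
  have "subgroup (normal_closure G R) G"
    unfolding normal_closure_def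
    using carrier assms by (intro subgroups_Inter) (auto intro: normal_imp_subgroup)
  then show ?thesis
    by (auto simp: normal_inv_iff normal_closure_def)
qed

lemma normal_closure_superset: "R \<subseteq> normal_closure G R"
  by (auto simp: normal_closure_def)

lemma normal_closure_subset: "N \<lhd> G \<Longrightarrow> R \<subseteq> N \<Longrightarrow> normal_closure G R \<subseteq> N"
  by (auto simp: normal_closure_def)

lemma finitely_presentedE:
  assumes "finitely_presented G" "group G"
  obtains k R \<pi> where "finite R" "R \<subseteq> carrier (free_group_rank k)"
    "\<pi> \<in> hom (free_group_rank k) G" "\<pi> ` carrier (free_group_rank k) = carrier G"
    "kernel (free_group_rank k) G \<pi> = normal_closure (free_group_rank k) R"
proof -
  obtain k R where R: "finite R" "R \<subseteq> carrier (free_group_rank k)"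
    and "free_group_rank k Mod normal_closure (free_group_rank k) R \<cong> G"
    using assms(1) by (auto simp: finitely_presented_def)
  then obtain h where h: "h \<in> iso (free_group_rank k Mod normal_closure (free_group_rank k) R) G"
    by (auto simp: is_iso_def)
  let ?F = "free_group_rank k" and ?N = "normal_closure (free_group_rank k) R"
  interpret G: group G by fact
  interpret F: group ?F by (rule group_free_group)
  interpret N: normal ?N ?F using F.normal_closure_normal[OF R(2)] .
  interpret Q: group "?F Mod ?N" by (rule N.factorgroup_is_group)
  let ?\<pi> = "h \<circ> (\<lambda>x. ?N #>\<^bsub>?F\<^esub> x)"
  have bij: "bij_betw h (carrier (?F Mod ?N)) (carrier G)"
    using h by (simp add: iso_def)
  have hom: "?\<pi> \<in> hom ?F G"
    using h N.r_coset_hom_Mod by (intro Group.hom_compose) (auto simp: iso_def)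
  have "?\<pi> ` carrier ?F = h ` carrier (?F Mod ?N)"
    by (simp add: carrier_FactGroup image_comp)
  then have surj: "?\<pi> ` carrier ?F = carrier G"
    using bij by (simp add: bij_betw_def)
  have "h (?N #>\<^bsub>?F\<^esub> x) = \<one>\<^bsub>G\<^esub> \<longleftrightarrow> x \<in> ?N" if x: "x \<in> carrier ?F" for x
  proof -
    have one: "h ?N = \<one>\<^bsub>G\<^esub>"
      using hom_one[of h "?F Mod ?N" G] h Q.is_group G.is_group by (simp add: iso_def)
    have "?N \<in> carrier (?F Mod ?N)" "?N #>\<^bsub>?F\<^esub> x \<in> carrier (?F Mod ?N)"
      using Q.one_closed x by (auto simp: carrier_FactGroup)
    then have "h (?N #>\<^bsub>?F\<^esub> x) = \<one>\<^bsub>G\<^esub> \<longleftrightarrow> ?N #>\<^bsub>?F\<^esub> x = ?N"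
      using bij one by (metis bij_betw_def inj_onD)
    also have "\<dots> \<longleftrightarrow> x \<in> ?N"
      using x F.coset_join2[OF x N.subgroup_axioms] F.rcos_self[OF x N.subgroup_axioms] by auto
    finally show ?thesis .
  qed
  then have "kernel ?F G ?\<pi> = ?N"
    using N.subset by (auto simp: kernel_def)
  then show ?thesis
    using that[OF R hom surj] by blast
qed

lemma surj_hom_factor:
  assumes "group F" "group G" "group P"
    and \<pi>: "\<pi> \<in> hom F G" "\<pi> ` carrier F = carrier G"
    and h: "h \<in> hom F P" and ker: "kernel F G \<pi> \<subseteq> kernel F P h"
  obtains \<theta> where "\<theta> \<in> hom G P" "\<And>x. x \<in> carrier F \<Longrightarrow> \<theta> (\<pi> x) = h x"
proof -
  interpret F: group F by fact
  interpret G: group G by fact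
  interpret P: group P by fact
  interpret \<pi>: group_hom F G \<pi> by unfold_locales (rule \<pi>)
  interpret h: group_hom F P h by unfold_locales (rule h)
  have eq: "h x = h y" if x: "x \<in> carrier F" and y: "y \<in> carrier F" and "\<pi> x = \<pi> y" for x y
  proof -
    have "x \<otimes>\<^bsub>F\<^esub> inv\<^bsub>F\<^esub> y \<in> kernel F G \<pi>"
      using that by (simp add: kernel_def)
    then have "h (x \<otimes>\<^bsub>F\<^esub> inv\<^bsub>F\<^esub> y) = \<one>\<^bsub>P\<^esub>"
      using ker kernel_def[of F P h] by blast
    then have "h x \<otimes>\<^bsub>P\<^esub> inv\<^bsub>P\<^esub> h y = \<one>\<^bsub>P\<^esub>" using x y by simp
    then show ?thesis
      using x y by (metis P.inv_closed P.inv_equality P.inv_inv h.hom_closed)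
  qed
  define \<theta> where "\<theta> g = h (SOME x. x \<in> carrier F \<and> \<pi> x = g)" for g
  have \<theta>: "\<theta> (\<pi> x) = h x" if "x \<in> carrier F" for x
  proof -
    have "(SOME y. y \<in> carrier F \<and> \<pi> y = \<pi> x) \<in> carrier F \<and> \<pi> (SOME y. y \<in> carrier F \<and> \<pi> y = \<pi> x) = \<pi> x"
      by (rule someI[of "\<lambda>y. y \<in> carrier F \<and> \<pi> y = \<pi> x" x]) (use that in simp)
    then show ?thesis unfolding \<theta>_def using eq that by blast
  qed
  have "\<theta> \<in> hom G P"
  proof (rule homI)
    fix g assume "g \<in> carrier G"
    then obtain x where "x \<in> carrier F" "g = \<pi> x" using \<pi>(2) by blast
    then show "\<theta> g \<in> carrier P" using \<theta> by simp
  next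
    fix g g' assume "g \<in> carrier G" "g' \<in> carrier G"
    then obtain x x' where "x \<in> carrier F" "g = \<pi> x" "x' \<in> carrier F" "g' = \<pi> x'" using \<pi>(2) by blast
    then show "\<theta> (g \<otimes>\<^bsub>G\<^esub> g') = \<theta> g \<otimes>\<^bsub>P\<^esub> \<theta> g'" using \<theta>[of "x \<otimes>\<^bsub>F\<^esub> x'"] \<theta> by simp
  qed
  then show ?thesis using that \<theta> by blast
qed

text \<open>
  A homomorphism defined on a group with finitely many relators has only finitely many equations to
  satisfy.  A family of maps in which each single instance of multiplicativity holds eventually thus
  satisfies all relators eventually, and from then on its values on the generators extend to a true
  homomorphism.  Expressing the elements of \<open>S\<close> in the generators takes finitely many further
  equations.
\<close>

lemma finitely_presented_asymptotic_hom:
  fixes \<Psi> :: "'i \<Rightarrow> 'g \<Rightarrow> 'p"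
  assumes "finitely_presented G" "group G" "group P"
    and closed: "\<And>i g. g \<in> carrier G \<Longrightarrow> \<Psi> i g \<in> carrier P"
    and mult: "\<And>g h. g \<in> carrier G \<Longrightarrow> h \<in> carrier G \<Longrightarrow>
      \<forall>\<^sub>F i in \<F>. \<Psi> i (g \<otimes>\<^bsub>G\<^esub> h) = \<Psi> i g \<otimes>\<^bsub>P\<^esub> \<Psi> i h"
    and S: "finite S" "S \<subseteq> carrier G"
  shows "\<forall>\<^sub>F i in \<F>. \<exists>\<theta>\<in>hom G P. \<forall>g\<in>S. \<theta> g = \<Psi> i g"
proof -
  obtain k R \<pi> where R: "finite R" "R \<subseteq> carrier (free_group_rank k)"
    and \<pi>: "\<pi> \<in> hom (free_group_rank k) G" "\<pi> ` carrier (free_group_rank k) = carrier G"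
    and ker: "kernel (free_group_rank k) G \<pi> = normal_closure (free_group_rank k) R"
    using finitely_presentedE[OF assms(1,2)] .
  let ?F = "free_group_rank k"
  interpret G: group G by fact
  interpret P: group P by fact
  interpret F: group ?F by (rule group_free_group)
  interpret \<pi>: group_hom ?F G \<pi> by unfold_locales (rule \<pi>)
  define s where "s i j = \<Psi> i (\<pi> [(j, True)])" for i j
  define h where "h i = word_image P (s i)" for i
  have s: "s i \<in> {..<k} \<rightarrow> carrier P" for i
    by (auto simp: s_def letter_in_free_group intro!: closed)
  have h: "h i \<in> hom ?F P" for i
    unfolding h_def by (rule P.word_image_hom[OF s])
  have one: "\<forall>\<^sub>F i in \<F>. \<Psi> i \<one>\<^bsub>G\<^esub> = \<one>\<^bsub>P\<^esub>"
    using mult[OF G.one_closed G.one_closed]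
    by eventually_elim (metis G.l_one G.one_closed P.l_cancel_one' closed)
  have letter: "\<forall>\<^sub>F i in \<F>. letter_image P (s i) a = \<Psi> i (\<pi> [a])" if a: "fst a \<in> {..<k}" for a
  proof (cases a)
    case (Pair j b)
    let ?x = "\<pi> [(j, True)]" and ?y = "\<pi> [(j, False)]"
    have j: "j \<in> {..<k}" using a Pair by simp
    have y: "?y = inv\<^bsub>G\<^esub> ?x" and x: "?x \<in> carrier G"
      using \<pi>.hom_inv[OF letter_in_free_group[OF j, of True]] j
      by (simp_all add: inv_letter_free_group letter_in_free_group)
    have "\<forall>\<^sub>F i in \<F>. \<Psi> i (?y \<otimes>\<^bsub>G\<^esub> ?x) = \<Psi> i ?y \<otimes>\<^bsub>P\<^esub> \<Psi> i ?x"
      using x y by (intro mult) auto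
    then have "\<forall>\<^sub>F i in \<F>. inv\<^bsub>P\<^esub> (\<Psi> i ?x) = \<Psi> i ?y"
      using one
    proof eventually_elim
      case (elim i)
      then show ?case using x y closed by (intro P.inv_equality) auto
    qed
    then show ?thesis
      by (cases b) (auto simp: Pair letter_image_def s_def)
  qed
  have agree: "\<forall>\<^sub>F i in \<F>. h i w = \<Psi> i (\<pi> w)" if "w \<in> carrier ?F" for w
    using that
  proof (induction w rule: free_group_induct)
    case one
    then show ?case using \<open>\<forall>\<^sub>F i in \<F>. \<Psi> i \<one>\<^bsub>G\<^esub> = \<one>\<^bsub>P\<^esub>\<close> \<pi>.hom_one
      by (simp add: h_def one_free_group eq_commute)
  next
    case (mult a w)
    have eq: "\<pi> (a # w) = \<pi> [a] \<otimes>\<^bsub>G\<^esub> \<pi> w"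
      using \<pi>.hom_mult[of "[a]" w] mult.hyps by simp
    have "\<forall>\<^sub>F i in \<F>. \<Psi> i (\<pi> [a] \<otimes>\<^bsub>G\<^esub> \<pi> w) = \<Psi> i (\<pi> [a]) \<otimes>\<^bsub>P\<^esub> \<Psi> i (\<pi> w)"
      using mult.hyps by (intro assms(5)) auto
    then show ?case
      using mult.IH letter[OF mult.hyps(1)]
      unfolding eq by eventually_elim (simp add: h_def)
  qed
  have "\<forall>\<^sub>F i in \<F>. \<forall>r\<in>R. h i r = \<one>\<^bsub>P\<^esub>"
  proof (rule eventually_ball_finite[OF R(1)], rule ballI)
    fix r assume r: "r \<in> R"
    then have "r \<in> normal_closure ?F R"
      using normal_closure_superset[of R ?F] by blast
    then have "r \<in> kernel ?F G \<pi>" by (simp only: ker)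
    then have "r \<in> carrier ?F" "\<pi> r = \<one>\<^bsub>G\<^esub>" by (auto simp: kernel_def)
    then show "\<forall>\<^sub>F i in \<F>. h i r = \<one>\<^bsub>P\<^esub>"
      using agree[of r] one by (auto elim: eventually_elim2)
  qed
  moreover define pre where "pre g = (SOME w. w \<in> carrier ?F \<and> \<pi> w = g)" for g
  have pre: "pre g \<in> carrier ?F" "\<pi> (pre g) = g" if "g \<in> carrier G" for g
  proof -
    have "\<exists>w. w \<in> carrier ?F \<and> \<pi> w = g" using that \<pi>(2) by (metis imageE)
    then have "pre g \<in> carrier ?F \<and> \<pi> (pre g) = g" unfolding pre_def by (rule someI_ex)
    then show "pre g \<in> carrier ?F" "\<pi> (pre g) = g" by auto
  qed
  have "\<forall>\<^sub>F i in \<F>. \<forall>g\<in>S. h i (pre g) = \<Psi> i g"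
  proof (rule eventually_ball_finite[OF S(1)], rule ballI)
    fix g assume "g \<in> S"
    then show "\<forall>\<^sub>F i in \<F>. h i (pre g) = \<Psi> i g"
      using agree[of "pre g"] pre[of g] S(2) by auto
  qed
  ultimately show ?thesis
  proof eventually_elim
    case (elim i)
    interpret h: group_hom ?F P "h i" by unfold_locales (rule h)
    have "normal_closure ?F R \<subseteq> kernel ?F P (h i)"
      by (rule normal_closure_subset[OF h.normal_kernel]) (use elim(1) R in \<open>auto simp: kernel_def\<close>)
    then obtain \<theta> where \<theta>: "\<theta> \<in> hom G P" "\<And>x. x \<in> carrier ?F \<Longrightarrow> \<theta> (\<pi> x) = h i x"
      using surj_hom_factor[OF F.is_group G.is_group P.is_group \<pi> h] ker by metis
    have "\<theta> g = \<Psi> i g" if "g \<in> S" for g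
      using \<theta>(2)[of "pre g"] pre[of g] elim(2) that S(2) by auto
    then show ?case using \<theta>(1) by blast
  qed
qed

section \<open>Split extensions with free quotient\<close>

text \<open>
  The permutations act on the whole type, so that multiplication is plain composition; a group
  acts on its own carrier and fixes everything outside.
\<close>

definition permutation_group :: "('a \<Rightarrow> 'a) monoid" where
  "permutation_group = \<lparr>carrier = {f. bij f}, mult = (\<circ>), one = id\<rparr>"

lemma permutation_group_simps [simp]:
  "f \<in> carrier permutation_group \<longleftrightarrow> bij f"
  "f \<otimes>\<^bsub>permutation_group\<^esub> g = f \<circ> g"
  "\<one>\<^bsub>permutation_group\<^esub> = id"
  by (simp_all add: permutation_group_def)

lemma group_permutation_group: "group permutation_group"
proof (rule groupI)
  fix f :: "'a \<Rightarrow> 'a" assume "f \<in> carrier permutation_group"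
  then show "\<exists>g\<in>carrier permutation_group. g \<otimes>\<^bsub>permutation_group\<^esub> f = \<one>\<^bsub>permutation_group\<^esub>"
    by (intro bexI[of _ "inv_into UNIV f"]) (auto simp: bij_imp_bij_inv bij_is_inj)
qed (auto simp: bij_comp comp_assoc)

lemma inv_permutation_group: "bij f \<Longrightarrow> inv\<^bsub>permutation_group\<^esub> f = inv_into UNIV f"
  by (rule group.inv_equality[OF group_permutation_group])
    (auto simp: bij_imp_bij_inv bij_is_inj)

context group
begin

definition left_translation :: "'a \<Rightarrow> 'a \<Rightarrow> 'a" where
  "left_translation g h = (if h \<in> carrier G then g \<otimes> h else h)"

text \<open>
  The permutation \<open>right_twist M c\<close> with \<open>c\<close> in the subgroup \<open>M\<close> multiplies by \<open>c\<close> on the single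
  \<open>M\<close>-orbit \<open>M\<close> and fixes all other orbits.  It commutes with left translation by elements of \<open>M\<close>,
  but if \<open>c \<noteq> \<one>\<close> with translation by no \<open>y\<close> outside \<open>M\<close>: it fixes \<open>y\<close> and sends \<open>\<one>\<close> to \<open>c\<close>.
\<close>

definition right_twist :: "'a set \<Rightarrow> 'a \<Rightarrow> 'a \<Rightarrow> 'a" where
  "right_twist M c h = (if h \<in> M then h \<otimes> c else h)"

lemma left_translation_mult:
  "g \<in> carrier G \<Longrightarrow> h \<in> carrier G \<Longrightarrow>
    left_translation (g \<otimes> h) = left_translation g \<circ> left_translation h"
  by (auto simp: left_translation_def fun_eq_iff m_assoc)

lemma left_translation_one: "left_translation \<one> = id"
  by (auto simp: left_translation_def fun_eq_iff)

lemma left_translation_bij: "g \<in> carrier G \<Longrightarrow> bij (left_translation g)"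
  by (rule o_bij[of "left_translation (inv g)"])
    (simp_all add: left_translation_one flip: left_translation_mult)

lemma left_translation_hom: "left_translation \<in> hom G permutation_group"
  by (rule homI) (auto simp: left_translation_mult left_translation_bij)

lemma right_twist_bij:
  assumes "subgroup M G" "c \<in> M"
  shows "bij (right_twist M c)"
proof -
  interpret M: subgroup M G by fact
  show ?thesis
    by (rule o_bij[of "right_twist M (inv c)"])
      (use assms in \<open>auto simp: right_twist_def fun_eq_iff m_assoc\<close>)
qed

lemma right_twist_commute:
  assumes "subgroup M G" "x \<in> M" "c \<in> M"
  shows "right_twist M c \<circ> left_translation x = left_translation x \<circ> right_twist M c"
proof
  interpret M: subgroup M G by fact
  have x: "x \<in> carrier G" and c: "c \<in> carrier G" using assms M.subset by auto
  fix h
  show "(right_twist M c \<circ> left_translation x) h = (left_translation x \<circ> right_twist M c) h"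
  proof (cases "h \<in> carrier G")
    case True
    have "x \<otimes> h \<in> M \<longleftrightarrow> h \<in> M"
    proof
      assume "x \<otimes> h \<in> M"
      then have "inv x \<otimes> (x \<otimes> h) \<in> M" using assms by simp
      then show "h \<in> M" using x True by (simp flip: m_assoc)
    qed (use assms in simp)
    then show ?thesis
      using True x c by (simp add: right_twist_def left_translation_def m_assoc)
  next
    case False
    then have "h \<notin> M" using M.subset by blast
    then show ?thesis using False by (simp add: right_twist_def left_translation_def)
  qed
qed

lemma generate_eqI:
  assumes "N \<subseteq> generate G S" "h \<in> hom G H" "h' \<in> hom G H" "group H" "S \<subseteq> carrier G"
    and "\<And>s. s \<in> S \<Longrightarrow> h s = h' s" and "x \<in> N"
  shows "h x = h' x"
proof -
  interpret H: group H by fact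
  interpret h: group_hom G H h by unfold_locales (rule assms)
  interpret h': group_hom G H h' by unfold_locales (rule assms)
  have "x \<in> generate G S" using assms by blast
  then show ?thesis
  proof induction
    case (inv s)
    then have "s \<in> carrier G" "h s = h' s" using assms(5,6) by auto
    then show ?case by simp
  next
    case (eng x y)
    then show ?case using generate_in_carrier[OF assms(5)] by simp
  qed (use assms in auto)
qed

end

text \<open>
  Write \<open>s\<^sub>k\<close> for \<open>\<sigma> [(k, True)]\<close>.  For a finite subset \<open>Z\<close> of \<open>N\<close> let \<open>M\<close> be the subgroup generated by \<open>Z\<close> and a fixed \<open>c \<noteq> \<one>\<close>.  Every
  generator acts on \<open>K\<close> by left translation, except that the action of \<open>s\<^sub>j\<close> is preceded by
  \<open>right_twist M c\<close>.  The relations that describe how \<open>s\<^sub>j\<close> conjugates elements of \<open>M\<close> stay valid,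
  and every element of \<open>N\<close> lies in \<open>M\<close> as soon as \<open>Z\<close> contains it.  Along the filter of finite subsets
  of \<open>N\<close> these actions form an asymptotic homomorphism.  If \<open>K\<close> were finitely presented, one of them
  would agree with a true homomorphism on the finitely many elements \<open>Y\<close>, \<open>s\<^sub>i\<close> and \<open>s\<^sub>j\<close>.
  As \<open>Y\<close> and \<open>s\<^sub>i\<close> generate a group that contains \<open>N\<close>, the twist would commute with translation by all of \<open>N\<close>, whereas \<open>M\<close> is a proper subgroup of \<open>N\<close>.
\<close>

theorem split_extension_not_finitely_presented:
  assumes "group K"
    and p: "p \<in> hom K (free_group X)"
    and \<sigma>: "\<sigma> \<in> hom (free_group X) K" "\<And>w. w \<in> carrier (free_group X) \<Longrightarrow> p (\<sigma> w) = w"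
    and ij: "i \<in> X" "j \<in> X" "i \<noteq> j"
    and N_def: "N = kernel K (free_group X) p"
    and Y: "finite Y" "Y \<subseteq> N" "N \<subseteq> generate K (insert (\<sigma> [(i, True)]) Y)"
    and not_fg: "\<And>Z. finite Z \<Longrightarrow> Z \<subseteq> N \<Longrightarrow> generate K Z \<noteq> N"
  shows "\<not> finitely_presented K"
proof
  assume fp: "finitely_presented K"
  let ?F = "free_group X" and ?P = "permutation_group :: ('a \<Rightarrow> 'a) monoid"
  let ?L = "group.left_translation K"
  interpret K: group K by fact
  interpret F: group ?F by (rule group_free_group)
  interpret P: group ?P by (rule group_permutation_group)
  interpret p: group_hom K ?F p by unfold_locales (rule p)
  interpret \<sigma>: group_hom ?F K \<sigma> by unfold_locales (rule \<sigma>)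
  have N: "N \<lhd> K" unfolding N_def by (rule p.normal_kernel)
  interpret N: normal N K by (rule N)
  have N_conj: "g \<otimes>\<^bsub>K\<^esub> y \<otimes>\<^bsub>K\<^esub> inv\<^bsub>K\<^esub> g \<in> N" if "g \<in> carrier K" "y \<in> N" for g y
    using N that by (simp add: K.normal_inv_iff)
  have "generate K {} = {\<one>\<^bsub>K\<^esub>}" by (rule K.generate_empty)
  then obtain c where c: "c \<in> N" "c \<noteq> \<one>\<^bsub>K\<^esub>"
    using not_fg[of "{}"] by fastforce
  define M where "M Z = generate K (insert c (Z \<inter> N))" for Z
  have M: "subgroup (M Z) K" and cM: "c \<in> M Z" and ZM: "Z \<inter> N \<subseteq> M Z" and MN: "M Z \<subseteq> N" for Z
  proof -
    have *: "insert c (Z \<inter> N) \<subseteq> N" using c by blast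
    show "subgroup (M Z) K"
      unfolding M_def by (rule K.generate_is_subgroup) (use * N.subset in blast)
    show "M Z \<subseteq> N"
      unfolding M_def by (rule K.generate_subgroup_incl[OF * N.subgroup_axioms])
  qed (auto simp: M_def intro: generate.incl)
  define \<tau> where "\<tau> Z = K.right_twist (M Z) c" for Z
  define s where "s k = \<sigma> [(k, True)]" for k
  have s: "s k \<in> carrier K" if "k \<in> X" for k
    using that by (simp add: s_def letter_in_free_group)
  define t where "t Z k = (if k = j then ?L (s k) \<circ> \<tau> Z else ?L (s k))" for Z k
  have t: "t Z \<in> X \<rightarrow> carrier ?P" for Z
    using s cM M by (auto simp: t_def \<tau>_def K.left_translation_bij K.right_twist_bij intro!: bij_comp)
  define \<Lambda> where "\<Lambda> Z = word_image ?P (t Z)" for Z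
  have \<Lambda>: "\<Lambda> Z \<in> hom ?F ?P" for Z
    unfolding \<Lambda>_def by (rule P.word_image_hom[OF t])
  \<comment> \<open>every \<open>g\<close> factors as an element of \<open>N\<close> times \<open>\<sigma> (p g)\<close>; the first factor acts by translation\<close>
  define \<Psi> where "\<Psi> Z g = ?L (g \<otimes>\<^bsub>K\<^esub> inv\<^bsub>K\<^esub> \<sigma> (p g)) \<circ> \<Lambda> Z (p g)" for Z g
  let ?ev = "\<lambda>P. \<forall>\<^sub>F Z in finite_subsets_at_top N. P Z"
  have ev_mem: "?ev (\<lambda>Z. x \<in> M Z)" if "x \<in> N" for x
  proof -
    have "?ev (\<lambda>Z. {x} \<subseteq> Z)"
      unfolding eventually_finite_subsets_at_top using that by (intro exI[of _ "{x}"]) auto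
    then show ?thesis
      by eventually_elim (use ZM that in blast)
  qed
  have pos: "?ev (\<lambda>Z. t Z k \<circ> ?L y = ?L (s k \<otimes>\<^bsub>K\<^esub> y \<otimes>\<^bsub>K\<^esub> inv\<^bsub>K\<^esub> s k) \<circ> t Z k)"
    if "k \<in> X" "y \<in> N" for k y
    using ev_mem[OF that(2)]
  proof eventually_elim
    case (elim Z)
    have "?L (s k \<otimes>\<^bsub>K\<^esub> y \<otimes>\<^bsub>K\<^esub> inv\<^bsub>K\<^esub> s k) \<circ> ?L (s k) = ?L (s k) \<circ> ?L y"
      using s[OF that(1)] that(2) by (simp add: K.m_assoc flip: K.left_translation_mult)
    moreover have "\<tau> Z \<circ> ?L y = ?L y \<circ> \<tau> Z"
      unfolding \<tau>_def by (rule K.right_twist_commute[OF M elim cM])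
    ultimately show ?case by (auto simp: t_def fun_eq_iff)
  qed
  have letter: "?ev (\<lambda>Z. letter_image ?P (t Z) a \<circ> ?L y =
      ?L (\<sigma> [a] \<otimes>\<^bsub>K\<^esub> y \<otimes>\<^bsub>K\<^esub> inv\<^bsub>K\<^esub> \<sigma> [a]) \<circ> letter_image ?P (t Z) a)"
    if a: "fst a \<in> X" and y: "y \<in> N" for a y
  proof (cases a)
    case (Pair k b)
    have k: "k \<in> X" using a Pair by simp
    show ?thesis
    proof (cases b)
      case True
      then show ?thesis using pos[OF k y] by (simp add: Pair letter_image_def s_def)
    next
      case False
      have inv: "\<sigma> [a] = inv\<^bsub>K\<^esub> s k"
        using \<sigma>.hom_inv[OF letter_in_free_group[OF k, of True]] k False Pair
        by (simp add: s_def inv_letter_free_group)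
      define y' where "y' = inv\<^bsub>K\<^esub> s k \<otimes>\<^bsub>K\<^esub> y \<otimes>\<^bsub>K\<^esub> s k"
      have y': "y' \<in> N" "s k \<otimes>\<^bsub>K\<^esub> y' \<otimes>\<^bsub>K\<^esub> inv\<^bsub>K\<^esub> s k = y"
        using N_conj[of "inv\<^bsub>K\<^esub> s k" y] s[OF k] y
        by (simp_all add: y'_def K.m_assoc K.inv_mult_cancel)
      show ?thesis
        using pos[OF k y'(1)]
      proof eventually_elim
        case (elim Z)
        have b: "bij (t Z k)" using t[of Z] k by (simp add: Pi_iff)
        have "inv_into UNIV (t Z k) \<circ> ?L y = ?L y' \<circ> inv_into UNIV (t Z k)"
        proof
          fix h
          obtain h' where h: "h = t Z k h'" using b by (metis bij_pointE)
          have "?L y h = t Z k (?L y' h')"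
            using elim y'(2) h by (simp add: fun_eq_iff)
          then show "(inv_into UNIV (t Z k) \<circ> ?L y) h = (?L y' \<circ> inv_into UNIV (t Z k)) h"
            using b h by (simp add: bij_is_inj)
        qed
        then show ?case
          using False Pair b s[OF k] inv by (simp add: letter_image_def inv_permutation_group y'_def)
      qed
    qed
  qed
  \<comment> \<open>the relations of the extension, one word at a time: only finitely many conjugates of \<open>y\<close> occur\<close>
  have conj: "\<forall>y\<in>N. ?ev (\<lambda>Z. \<Lambda> Z w \<circ> ?L y = ?L (\<sigma> w \<otimes>\<^bsub>K\<^esub> y \<otimes>\<^bsub>K\<^esub> inv\<^bsub>K\<^esub> \<sigma> w) \<circ> \<Lambda> Z w)"
    if "w \<in> carrier ?F" for w
    using that
  proof (induction w rule: free_group_induct)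
    case one
    then show ?case
      using \<sigma>.hom_one by (auto simp: \<Lambda>_def one_free_group)
  next
    case (mult a w)
    show ?case
    proof
      fix y assume y: "y \<in> N"
      define z where "z = \<sigma> w \<otimes>\<^bsub>K\<^esub> y \<otimes>\<^bsub>K\<^esub> inv\<^bsub>K\<^esub> \<sigma> w"
      have z: "z \<in> N" using N_conj y mult.hyps by (simp add: z_def)
      have eq: "\<sigma> (a # w) \<otimes>\<^bsub>K\<^esub> y \<otimes>\<^bsub>K\<^esub> inv\<^bsub>K\<^esub> \<sigma> (a # w) = \<sigma> [a] \<otimes>\<^bsub>K\<^esub> z \<otimes>\<^bsub>K\<^esub> inv\<^bsub>K\<^esub> \<sigma> [a]"
        using \<sigma>.hom_mult[of "[a]" w] mult.hyps y
        by (simp add: z_def K.m_assoc K.inv_mult_group)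
      show "?ev (\<lambda>Z. \<Lambda> Z (a # w) \<circ> ?L y =
          ?L (\<sigma> (a # w) \<otimes>\<^bsub>K\<^esub> y \<otimes>\<^bsub>K\<^esub> inv\<^bsub>K\<^esub> \<sigma> (a # w)) \<circ> \<Lambda> Z (a # w))"
        using mult.IH[rule_format, OF y] letter[OF mult.hyps(1) z]
        unfolding eq z_def[symmetric]
        by eventually_elim (simp add: \<Lambda>_def fun_eq_iff)
    qed
  qed
  have dec: "g \<otimes>\<^bsub>K\<^esub> inv\<^bsub>K\<^esub> \<sigma> (p g) \<in> N" if "g \<in> carrier K" for g
  proof -
    have pg: "p g \<in> carrier ?F" and \<sigma>pg: "\<sigma> (p g) \<in> carrier K" using that by simp_all
    have "p (g \<otimes>\<^bsub>K\<^esub> inv\<^bsub>K\<^esub> \<sigma> (p g)) = p g \<otimes>\<^bsub>?F\<^esub> inv\<^bsub>?F\<^esub> p (\<sigma> (p g))"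
      using p.hom_mult[OF that K.inv_closed[OF \<sigma>pg]] p.hom_inv[OF \<sigma>pg] by (simp only:)
    also have "\<dots> = \<one>\<^bsub>?F\<^esub>"
      unfolding \<sigma>(2)[OF pg] by (rule F.r_inv[OF pg])
    finally show ?thesis
      using that \<sigma>pg unfolding N_def kernel_def by blast
  qed
  have "?ev (\<lambda>Z. \<exists>\<theta>\<in>hom K ?P. \<forall>g\<in>insert (s i) (insert (s j) Y). \<theta> g = \<Psi> Z g)"
  proof (rule finitely_presented_asymptotic_hom[OF fp K.is_group P.is_group])
    show "\<Psi> Z g \<in> carrier ?P" if "g \<in> carrier K" for Z g
    proof -
      have "\<Lambda> Z (p g) \<in> carrier ?P" using \<Lambda> that p.hom_closed by (meson hom_in_carrier)
      then show ?thesis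
        using that by (simp add: \<Psi>_def K.left_translation_bij bij_comp)
    qed
  next
    fix g h assume g: "g \<in> carrier K" and h: "h \<in> carrier K"
    let ?x = "g \<otimes>\<^bsub>K\<^esub> inv\<^bsub>K\<^esub> \<sigma> (p g)" and ?y = "h \<otimes>\<^bsub>K\<^esub> inv\<^bsub>K\<^esub> \<sigma> (p h)"
    let ?z = "\<sigma> (p g) \<otimes>\<^bsub>K\<^esub> ?y \<otimes>\<^bsub>K\<^esub> inv\<^bsub>K\<^esub> \<sigma> (p g)"
    have eq: "g \<otimes>\<^bsub>K\<^esub> h \<otimes>\<^bsub>K\<^esub> inv\<^bsub>K\<^esub> \<sigma> (p (g \<otimes>\<^bsub>K\<^esub> h)) = ?x \<otimes>\<^bsub>K\<^esub> ?z"
      using g h by (simp add: K.m_assoc K.inv_mult_group K.inv_mult_cancel)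
    show "?ev (\<lambda>Z. \<Psi> Z (g \<otimes>\<^bsub>K\<^esub> h) = \<Psi> Z g \<otimes>\<^bsub>?P\<^esub> \<Psi> Z h)"
      using conj[OF p.hom_closed[OF g], rule_format, OF dec[OF h]]
    proof eventually_elim
      case (elim Z)
      have "\<Psi> Z (g \<otimes>\<^bsub>K\<^esub> h) = ?L ?x \<circ> (?L ?z \<circ> \<Lambda> Z (p g)) \<circ> \<Lambda> Z (p h)"
        using hom_mult[OF \<Lambda> p.hom_closed[OF g] p.hom_closed[OF h], of Z] g h
        unfolding \<Psi>_def eq by (simp add: K.left_translation_mult comp_assoc)
      also have "\<dots> = \<Psi> Z g \<circ> \<Psi> Z h"
        unfolding elim[symmetric] \<Psi>_def by (simp add: comp_assoc)
      finally show ?case by simp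
    qed
  next
    show "finite (insert (s i) (insert (s j) Y))" using Y by simp
    show "insert (s i) (insert (s j) Y) \<subseteq> carrier K" using Y ij s N.subset by blast
  qed
  moreover have "?ev finite"
    by (rule eventually_finite_subsets_at_top_weakI)
  ultimately have "?ev (\<lambda>Z. finite Z \<and>
      (\<exists>\<theta>\<in>hom K ?P. \<forall>g\<in>insert (s i) (insert (s j) Y). \<theta> g = \<Psi> Z g))"
    by (rule eventually_conj[rotated])
  from eventually_happens'[OF finite_subsets_at_top_neq_bot this]
  obtain Z \<theta> where Z: "finite Z" and \<theta>: "\<theta> \<in> hom K ?P"
    and \<theta>_eq: "\<And>g. g \<in> insert (s i) (insert (s j) Y) \<Longrightarrow> \<theta> g = \<Psi> Z g"
    by blast
  interpret \<theta>: group_hom K ?P \<theta> by unfold_locales (rule \<theta>)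
  have \<Psi>_s: "\<Psi> Z (s k) = t Z k" if "k \<in> X" for k
  proof -
    have "p (s k) = [(k, True)]"
      unfolding s_def by (rule \<sigma>(2)[OF letter_in_free_group[OF that]])
    then have "\<Psi> Z (s k) = ?L (s k \<otimes>\<^bsub>K\<^esub> inv\<^bsub>K\<^esub> s k) \<circ> t Z k"
      unfolding \<Psi>_def \<Lambda>_def by (simp only: P.word_image_letter[OF t that] flip: s_def)
    then show ?thesis
      unfolding K.r_inv[OF s[OF that]] K.left_translation_one by simp
  qed
  \<comment> \<open>no twist enters the action of \<open>Y\<close> and \<open>s i\<close>, and the group that they generate contains \<open>N\<close>\<close>
  have \<theta>_N: "\<theta> y = ?L y" if "y \<in> N" for y
  proof (rule K.generate_eqI[OF Y(3) \<theta> K.left_translation_hom P.is_group _ _ that])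
    show "insert (\<sigma> [(i, True)]) Y \<subseteq> carrier K" using Y s[OF ij(1)] N.subset by (auto simp: s_def)
  next
    fix g assume "g \<in> insert (\<sigma> [(i, True)]) Y"
    then consider "g = s i" | "g \<in> Y" by (auto simp: s_def)
    then show "\<theta> g = ?L g"
    proof cases
      case 1
      then show ?thesis using \<theta>_eq[of g] \<Psi>_s[OF ij(1)] ij by (simp add: t_def)
    next
      case 2
      then have gN: "g \<in> N" using Y(2) by blast
      have "g \<in> carrier K" by (rule N.mem_carrier[OF gN])
      moreover have "p g = []" using gN unfolding N_def kernel_def one_free_group by blast
      moreover have "\<sigma> [] = \<one>\<^bsub>K\<^esub>" using \<sigma>.hom_one by (simp add: one_free_group)
      ultimately show ?thesis
        using 2 \<theta>_eq[of g] by (simp add: \<Psi>_def \<Lambda>_def)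
    qed
  qed
  have "M Z \<noteq> N" unfolding M_def by (rule not_fg) (use Z c in auto)
  then obtain y where y: "y \<in> N" "y \<notin> M Z" using MN by blast
  \<comment> \<open>the relation \<open>s j \<otimes> y = z \<otimes> s j\<close>, evaluated at \<open>\<one>\<close>, compares \<open>y\<close> with \<open>y \<otimes> c\<close>\<close>
  let ?z = "s j \<otimes>\<^bsub>K\<^esub> y \<otimes>\<^bsub>K\<^esub> inv\<^bsub>K\<^esub> s j"
  have z: "?z \<in> N" "s j \<otimes>\<^bsub>K\<^esub> y = ?z \<otimes>\<^bsub>K\<^esub> s j"
    using N_conj y s[OF ij(2)] by (auto simp: K.m_assoc)
  have \<theta>_sj: "\<theta> (s j) = ?L (s j) \<circ> \<tau> Z"
    using \<theta>_eq[of "s j"] \<Psi>_s[OF ij(2)] by (simp add: t_def)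
  have "\<theta> (s j) \<circ> \<theta> y = \<theta> ?z \<circ> \<theta> (s j)"
    using \<theta>.hom_mult[of "s j" y] \<theta>.hom_mult[of ?z "s j"] z y s[OF ij(2)] by simp
  then have "(?L (s j) \<circ> \<tau> Z \<circ> ?L y) \<one>\<^bsub>K\<^esub> = (?L ?z \<circ> ?L (s j) \<circ> \<tau> Z) \<one>\<^bsub>K\<^esub>"
    using \<theta>_N[OF y(1)] \<theta>_N[OF z(1)] \<theta>_sj by (simp add: comp_assoc)
  moreover have "\<one>\<^bsub>K\<^esub> \<in> M Z" using M by (rule subgroup.one_closed)
  ultimately have "s j \<otimes>\<^bsub>K\<^esub> y = ?z \<otimes>\<^bsub>K\<^esub> (s j \<otimes>\<^bsub>K\<^esub> c)"
    using y s[OF ij(2)] c by (simp add: K.left_translation_def \<tau>_def K.right_twist_def)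
  then have "s j \<otimes>\<^bsub>K\<^esub> (y \<otimes>\<^bsub>K\<^esub> \<one>\<^bsub>K\<^esub>) = s j \<otimes>\<^bsub>K\<^esub> (y \<otimes>\<^bsub>K\<^esub> c)"
    using y c s[OF ij(2)] by (simp add: K.m_assoc K.inv_mult_cancel)
  then show False
    using y c s[OF ij(2)] by simp
qed

section \<open>Kernels of integral weights are not finitely generated\<close>

text \<open>
  All prefixes of the word, including the empty one and the word itself, have weight between \<open>p\<close>
  and \<open>q\<close>; the bounds are relative to the starting point and shift as letters are read.
\<close>

fun confined :: "('x \<Rightarrow> int) \<Rightarrow> int \<Rightarrow> int \<Rightarrow> ('x \<times> bool) list \<Rightarrow> bool" where
  "confined v p q [] \<longleftrightarrow> p \<le> 0 \<and> 0 \<le> q"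
| "confined v p q (a # w) \<longleftrightarrow>
    p \<le> 0 \<and> 0 \<le> q \<and> confined v (p - letter_weight v a) (q - letter_weight v a) w"

lemma confined_zero: "confined v p q w \<Longrightarrow> p \<le> 0 \<and> 0 \<le> q"
  by (cases w) auto

lemma confined_append:
  "confined v p q (u @ w) \<Longrightarrow> confined v (p - weight v u) (q - weight v u) w"
  by (induction u arbitrary: p q) (auto simp flip: diff_diff_eq)

lemma confined_mono: "confined v p q w \<Longrightarrow> p' \<le> p \<Longrightarrow> q \<le> q' \<Longrightarrow> confined v p' q' w"
proof (induction w arbitrary: p q p' q')
  case (Cons a w)
  have "confined v (p' - letter_weight v a) (q' - letter_weight v a) w"
    by (rule Cons.IH[of "p - letter_weight v a" "q - letter_weight v a"]) (use Cons.prems in auto)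
  then show ?case using Cons.prems by auto
qed auto

lemma confined_cons_cancel: "confined v p q (a # w) \<Longrightarrow> confined v p q (cons_cancel a w)"
  by (cases w) auto

text \<open>
  Cancellation only removes prefixes: as elements of the free group, those of the reduced product
  are among the prefixes of the concatenation.
\<close>

lemma confined_foldr:
  "confined v p q u \<Longrightarrow> confined v (p - weight v u) (q - weight v u) w \<Longrightarrow>
    confined v p q (foldr cons_cancel u w)"
proof (induction u arbitrary: p q)
  case (Cons a u)
  have "confined v (p - letter_weight v a) (q - letter_weight v a) (foldr cons_cancel u w)"
    by (rule Cons.IH) (use Cons.prems in \<open>auto simp: algebra_simps\<close>)
  then show ?case using Cons.prems confined_cons_cancel by fastforce
qed simp

lemma confined_mult:
  "confined v p q u \<Longrightarrow> confined v (p - weight v u) (q - weight v u) w \<Longrightarrow>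
    confined v p q (u \<otimes>\<^bsub>free_group X\<^esub> w)"
  by (simp add: mult_free_group confined_foldr)

lemma ex_confined: "\<exists>D\<ge>0. confined v (- D) D w"
proof (induction w)
  case Nil
  show ?case by (intro exI[of _ 0]) auto
next
  case (Cons a w)
  then obtain D where D: "D \<ge> 0" "confined v (- D) D w" by blast
  have "confined v (- (D + \<bar>letter_weight v a\<bar>)) (D + \<bar>letter_weight v a\<bar>) (a # w)"
    using confined_mono[OF D(2)] D(1) by auto
  then show ?case using D(1) by (intro exI[of _ "D + \<bar>letter_weight v a\<bar>"]) auto
qed

lemma ex_confined_finite:
  assumes "finite W"
  obtains D where "D \<ge> 0" "\<And>w. w \<in> W \<Longrightarrow> confined v (- D) D w"
proof -
  have "\<exists>D\<ge>0. \<forall>w\<in>W. confined v (- D) D w"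
    using assms
  proof induction
    case (insert w W)
    obtain D where D: "D \<ge> 0" "\<forall>w\<in>W. confined v (- D) D w" using insert.IH by blast
    obtain D' where D': "D' \<ge> 0" "confined v (- D') D' w" using ex_confined by blast
    show ?case
      using confined_mono[of v "- D" D] confined_mono[OF D'(2)] D D'
      by (intro exI[of _ "max D D'"]) auto
  qed (auto intro: exI[of _ 0])
  then show ?thesis using that by blast
qed

definition weight_kernel :: "'x set \<Rightarrow> ('x \<Rightarrow> int) \<Rightarrow> ('x \<times> bool) list set" where
  "weight_kernel X v = {w \<in> carrier (free_group X). weight v w = 0}"

lemma reduced_replicate_append:
  "reduced w \<Longrightarrow> w = [] \<or> hd w \<noteq> inv_letter a \<Longrightarrow> reduced (replicate k a @ w)"
proof (induction k)
  case (Suc k)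
  then show ?case by (cases k) (auto simp: reduced_Cons)
qed simp

lemma weight_replicate: "weight v (replicate k a) = int k * letter_weight v a"
  for v :: "'x \<Rightarrow> int"
  by (induction k) (auto simp: algebra_simps)

text \<open>
  Elements of weight \<open>0\<close> whose prefixes have weights in a fixed interval around \<open>0\<close> are closed
  under products.  A finitely generated subgroup of the kernel thus has a uniform bound on prefix
  weights.  The commutators of \<open>x\<^sup>k\<close> and \<open>y\<close>, for generators \<open>x \<noteq> y\<close> with \<open>x\<close> of nonzero weight,
  lie in the kernel and violate any such bound.
\<close>

theorem weight_kernel_not_finitely_generated:
  assumes ij: "i \<in> X" "j \<in> X" "i \<noteq> j" and v: "v i \<noteq> 0"
    and Z: "finite Z" "Z \<subseteq> weight_kernel X v"
  shows "generate (free_group X) Z \<noteq> weight_kernel X v"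
proof
  assume gen: "generate (free_group X) Z = weight_kernel X v"
  interpret group "free_group X" by (rule group_free_group)
  obtain D where D: "D \<ge> 0"
    "\<And>z. z \<in> Z \<union> (\<lambda>z. inv\<^bsub>free_group X\<^esub> z) ` Z \<Longrightarrow> confined v (- D) D z"
    using ex_confined_finite[of "Z \<union> (\<lambda>z. inv\<^bsub>free_group X\<^esub> z) ` Z"] Z(1) by blast
  have bound: "weight v w = 0 \<and> confined v (- D) D w" if "w \<in> generate (free_group X) Z" for w
    using that
  proof induction
    case one
    then show ?case using D(1) by (simp add: one_free_group)
  next
    case (incl w)
    then show ?case using D(2)[of w] Z(2) by (auto simp: weight_kernel_def)
  next
    case (inv w)
    then show ?case using D(2)[of "inv\<^bsub>free_group X\<^esub> w"] Z(2) by (auto simp: weight_kernel_def)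
  next
    case (eng u w)
    then show ?case by (auto intro: confined_mult)
  qed
  define k where "k = Suc (nat D)"
  let ?u = "replicate k (i, True)"
  let ?w = "(j, True) # replicate k (i, False) @ [(j, False)]"
  have "reduced (replicate k (i, False) @ [(j, False)])"
    by (rule reduced_replicate_append) (use ij in \<open>auto simp: inv_letter_def reduced_def\<close>)
  then have "reduced (?u @ ?w)"
    by (intro reduced_replicate_append) (use ij in \<open>auto simp: reduced_Cons inv_letter_def k_def\<close>)
  moreover have "weight v (?u @ ?w) = 0"
    by (simp add: weight_replicate letter_weight_def)
  ultimately have "?u @ ?w \<in> weight_kernel X v"
    using ij by (auto simp: weight_kernel_def carrier_free_group)
  then have "confined v (- D) D (?u @ ?w)"
    using bound gen by blast
  then have "confined v (- D - weight v ?u) (D - weight v ?u) ?w"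
    by (rule confined_append)
  then have "\<bar>int k * v i\<bar> \<le> D"
    by (auto simp: weight_replicate letter_weight_def)
  moreover have "int k * 1 \<le> int k * \<bar>v i\<bar>"
    using v by (intro mult_left_mono) auto
  moreover have "int k = D + 1" using D(1) by (simp add: k_def)
  ultimately show False
    by (simp only: abs_mult abs_of_nat mult_1_right)
qed

section \<open>A finite generating set relative to a twisted automorphism\<close>

text \<open>
  Reading the image of a word letter by letter, each letter contributes a detour of size at most
  \<open>D\<close>, and between the detours the weight is that of a prefix of the original word.
\<close>

lemma confined_hom:
  assumes h: "h \<in> hom (free_group X) (free_group X)"
    and weight: "\<And>w. w \<in> carrier (free_group X) \<Longrightarrow> weight v (h w) = weight v w"
    and D: "\<And>y. fst y \<in> X \<Longrightarrow> confined v (- D) D (h [y])" "D \<ge> 0"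
    and w: "w \<in> carrier (free_group X)" "confined v p q w"
  shows "confined v (p - D) (q + D) (h w)"
  using w
proof (induction w arbitrary: p q rule: free_group_induct)
  case one
  have "h [] = []"
    using hom_one[OF h group_free_group group_free_group] by (simp add: one_free_group)
  then show ?case using one D(2) by simp
next
  case (mult a w)
  have "h (a # w) = h [a] \<otimes>\<^bsub>free_group X\<^esub> h w"
    using hom_mult[OF h, of "[a]" w] mult.hyps by simp
  moreover have "confined v (p - D) (q + D) (h [a])"
    by (rule confined_mono[OF D(1)]) (use mult.prems mult.hyps in auto)
  moreover have "confined v (p - letter_weight v a - D) (q - letter_weight v a + D) (h w)"
    by (rule mult.IH) (use mult.prems in simp)
  ultimately show ?case
    using weight[of "[a]"] mult.hyps by (simp add: confined_mult algebra_simps)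
qed

locale unit_weight =
  fixes X :: "'x set" and v :: "'x \<Rightarrow> int" and a :: "('x \<times> bool) list"
  assumes a: "a \<in> carrier (free_group X)" and weight_a: "weight v a = 1"
begin

abbreviation F :: "('x \<times> bool) list monoid" where "F \<equiv> free_group X"

sublocale group F by (rule group_free_group)

text \<open>
  The powers of \<open>a\<close> form a transversal of the kernel of the weight.  For a letter \<open>w\<close> these are the
  Schreier generators; for longer words \<open>schreier\<close> is the cocycle that they define, so that an
  element of the kernel is the product of the Schreier generators met along its letters.
\<close>

definition schreier :: "int \<Rightarrow> ('x \<times> bool) list \<Rightarrow> ('x \<times> bool) list" where
  "schreier k w = a [^]\<^bsub>F\<^esub> k \<otimes>\<^bsub>F\<^esub> (w \<otimes>\<^bsub>F\<^esub> a [^]\<^bsub>F\<^esub> (- (k + weight v w)))"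

lemma weight_pow [simp]: "weight v (a [^]\<^bsub>F\<^esub> (k::int)) = k"
  by (simp add: weight_int_pow a weight_a)

lemma schreier_closed: "w \<in> carrier F \<Longrightarrow> schreier k w \<in> carrier F"
  by (simp add: schreier_def a)

lemma schreier_weight_kernel: "w \<in> carrier F \<Longrightarrow> schreier k w \<in> weight_kernel X v"
  using schreier_closed by (simp add: weight_kernel_def) (simp add: schreier_def)

lemma schreier_zero: "w \<in> weight_kernel X v \<Longrightarrow> schreier 0 w = w"
  by (simp add: schreier_def weight_kernel_def)

lemma schreier_mult:
  assumes "u \<in> carrier F" "w \<in> carrier F"
  shows "schreier k (u \<otimes>\<^bsub>F\<^esub> w) = schreier k u \<otimes>\<^bsub>F\<^esub> schreier (k + weight v u) w"
proof -
  have "(a [^]\<^bsub>F\<^esub> k \<otimes>\<^bsub>F\<^esub> (u \<otimes>\<^bsub>F\<^esub> a [^]\<^bsub>F\<^esub> (- j))) \<otimes>\<^bsub>F\<^esub> (a [^]\<^bsub>F\<^esub> j \<otimes>\<^bsub>F\<^esub> (w \<otimes>\<^bsub>F\<^esub> a [^]\<^bsub>F\<^esub> l)) =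
      a [^]\<^bsub>F\<^esub> k \<otimes>\<^bsub>F\<^esub> (u \<otimes>\<^bsub>F\<^esub> (w \<otimes>\<^bsub>F\<^esub> a [^]\<^bsub>F\<^esub> l))" for j l :: int
    using assms a by (simp add: m_assoc int_pow_neg inv_mult_cancel)
  from this[of "k + weight v u" "- (k + weight v u + weight v w)"] show ?thesis
    using assms a by (simp only: schreier_def weight_mult m_assoc int_pow_closed m_closed add.assoc)
qed

lemma schreier_shift:
  assumes "w \<in> carrier F"
  shows "a [^]\<^bsub>F\<^esub> P \<otimes>\<^bsub>F\<^esub> (schreier k w \<otimes>\<^bsub>F\<^esub> a [^]\<^bsub>F\<^esub> (- P)) = schreier (P + k) w"
proof -
  have pow: "a [^]\<^bsub>F\<^esub> x \<otimes>\<^bsub>F\<^esub> a [^]\<^bsub>F\<^esub> y = a [^]\<^bsub>F\<^esub> (x + y)" for x y :: int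
    by (rule int_pow_mult[OF a, symmetric])
  have "a [^]\<^bsub>F\<^esub> P \<otimes>\<^bsub>F\<^esub> (schreier k w \<otimes>\<^bsub>F\<^esub> a [^]\<^bsub>F\<^esub> (- P)) =
    (a [^]\<^bsub>F\<^esub> P \<otimes>\<^bsub>F\<^esub> a [^]\<^bsub>F\<^esub> k) \<otimes>\<^bsub>F\<^esub> (w \<otimes>\<^bsub>F\<^esub> (a [^]\<^bsub>F\<^esub> (- (k + weight v w)) \<otimes>\<^bsub>F\<^esub> a [^]\<^bsub>F\<^esub> (- P)))"
    unfolding schreier_def using assms a by (simp add: m_assoc)
  then show ?thesis
    unfolding pow schreier_def by (simp add: algebra_simps)
qed

text \<open>
  The Schreier generators used by a word that starts at height \<open>k\<close> sit at the heights of its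
  prefixes.
\<close>

lemma schreier_mem:
  assumes A: "subgroup A F"
    and letters: "\<And>k y. \<bar>k\<bar> \<le> q \<Longrightarrow> fst y \<in> X \<Longrightarrow> schreier k [y] \<in> A"
    and w: "w \<in> carrier F" "confined v (- q - k) (q - k) w"
  shows "schreier k w \<in> A"
  using w
proof (induction w arbitrary: k rule: free_group_induct)
  case one
  have "schreier k [] = \<one>\<^bsub>F\<^esub>"
    using a by (simp add: schreier_def int_pow_neg flip: one_free_group[of X])
  then show ?case using subgroup.one_closed[OF A] by simp
next
  case (mult y w)
  have "schreier k (y # w) = schreier k [y] \<otimes>\<^bsub>F\<^esub> schreier (k + letter_weight v y) w"
    using schreier_mult[of "[y]" w k] mult.hyps by simp
  moreover have "schreier k [y] \<in> A"
    by (rule letters) (use mult in auto)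
  moreover have "schreier (k + letter_weight v y) w \<in> A"
    by (rule mult.IH) (use mult.prems in \<open>auto simp: algebra_simps\<close>)
  ultimately show ?case using subgroup.m_closed[OF A] by simp
qed

lemma weight_kernel_mem:
  assumes "subgroup A F" "\<And>k y. \<bar>k\<bar> \<le> q \<Longrightarrow> fst y \<in> X \<Longrightarrow> schreier k [y] \<in> A"
    and "w \<in> weight_kernel X v" "confined v (- q) q w"
  shows "w \<in> A"
  using schreier_mem[OF assms(1,2), of q w 0] assms(3,4) schreier_zero[OF assms(3)]
  by (simp add: weight_kernel_def)

lemma confined_nat_pow:
  assumes "b \<in> carrier F" "\<bar>weight v b\<bar> = 1" "confined v (- D) D b"
  shows "confined v (min 0 (int k * weight v b) - D) (max 0 (int k * weight v b) + D) (b [^]\<^bsub>F\<^esub> k)"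
proof (induction k)
  case 0
  then show ?case using confined_zero[OF assms(3)] by (simp add: one_free_group)
next
  case (Suc k)
  have w: "weight v (b [^]\<^bsub>F\<^esub> k) = int k * weight v b"
    using weight_int_pow[OF assms(1), of v "int k"] by (simp add: int_pow_int)
  consider "weight v b = 1" | "weight v b = - 1" using assms(2) by linarith
  then show ?case
    unfolding nat_pow_Suc
    by cases (rule confined_mult; rule confined_mono[OF Suc] confined_mono[OF assms(3)]; simp add: w)+
qed

lemma confined_int_pow:
  assumes "confined v (- D) D a" "confined v (- D) D (inv\<^bsub>F\<^esub> a)"
  shows "confined v (min 0 k - D) (max 0 k + D) (a [^]\<^bsub>F\<^esub> (k::int))"
proof (cases "k \<ge> 0")
  case True
  then show ?thesis
    using confined_nat_pow[OF a _ assms(1), of "nat k"] int_pow_int[of F a "nat k"] weight_a by simp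
next
  case False
  define j where "j = nat (- k)"
  have "a [^]\<^bsub>F\<^esub> k = (inv\<^bsub>F\<^esub> a) [^]\<^bsub>F\<^esub> j"
  proof -
    have "k = - int j" using False by (simp add: j_def)
    then show ?thesis by (simp only: int_pow_neg_int[OF a] nat_pow_inv[OF a])
  qed
  moreover have "confined v (min 0 (int j * weight v (inv\<^bsub>F\<^esub> a)) - D)
      (max 0 (int j * weight v (inv\<^bsub>F\<^esub> a)) + D) ((inv\<^bsub>F\<^esub> a) [^]\<^bsub>F\<^esub> j)"
    by (rule confined_nat_pow) (use assms a weight_a in simp_all)
  ultimately show ?thesis
    using False a weight_a by (simp add: j_def)
qed

lemma confined_schreier_letter:
  assumes D: "confined v (- D) D a" "confined v (- D) D (inv\<^bsub>F\<^esub> a)"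
    and y: "fst y \<in> X" "\<bar>letter_weight v y\<bar> \<le> D"
  shows "confined v (min 0 k - 2 * D) (max 0 k + 2 * D) (schreier k [y])"
  unfolding schreier_def
proof (rule confined_mult)
  have D0: "D \<ge> 0" using confined_zero[OF D(1)] by simp
  show "confined v (min 0 k - 2 * D) (max 0 k + 2 * D) (a [^]\<^bsub>F\<^esub> k)"
    by (rule confined_mono[OF confined_int_pow[OF D]]) (use D0 in auto)
  show "confined v (min 0 k - 2 * D - weight v (a [^]\<^bsub>F\<^esub> k)) (max 0 k + 2 * D - weight v (a [^]\<^bsub>F\<^esub> k))
      ([y] \<otimes>\<^bsub>F\<^esub> a [^]\<^bsub>F\<^esub> (- (k + weight v [y])))"
  proof (rule confined_mult)
    show "confined v (min 0 k - 2 * D - weight v (a [^]\<^bsub>F\<^esub> k)) (max 0 k + 2 * D - weight v (a [^]\<^bsub>F\<^esub> k)) [y]"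
      using y(2) D0 by auto
    show "confined v (min 0 k - 2 * D - weight v (a [^]\<^bsub>F\<^esub> k) - weight v [y])
        (max 0 k + 2 * D - weight v (a [^]\<^bsub>F\<^esub> k) - weight v [y])
        (a [^]\<^bsub>F\<^esub> (- (k + weight v [y])))"
      by (rule confined_mono[OF confined_int_pow[OF D]]) (use y(2) D0 in auto)
  qed
qed

text \<open>
  Suppose that \<open>A\<close> contains all Schreier generators at heights up to \<open>q\<close> in absolute value, and
  hence every element of the kernel whose prefix weights stay in \<open>[-q, q]\<close>.  Conjugation by \<open>a\<^sup>P\<close>
  composed with \<open>h\<close> brings the generators at height \<open>-q - 1\<close> into this range, since the shift by
  \<open>P\<close> exceeds the bounded spread caused by \<open>h\<close>; the inverse operation does the same
  for those at height \<open>q + 1\<close>.  So \<open>A\<close> contains the generators at heights up to \<open>q + 1\<close>.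
\<close>

theorem weight_kernel_twisted_generators:
  assumes X: "finite X"
    and h: "h \<in> hom F F" "h' \<in> hom F F" "\<And>w. w \<in> carrier F \<Longrightarrow> h (h' w) = w"
    and weight: "\<And>w. w \<in> carrier F \<Longrightarrow> weight v (h w) = weight v w"
  obtains P :: int and Y where "finite Y" "Y \<subseteq> weight_kernel X v"
    "\<And>A. subgroup A F \<Longrightarrow> Y \<subseteq> A \<Longrightarrow>
      (\<And>w. w \<in> weight_kernel X v \<Longrightarrow>
        w \<in> A \<longleftrightarrow> a [^]\<^bsub>F\<^esub> P \<otimes>\<^bsub>F\<^esub> (h w \<otimes>\<^bsub>F\<^esub> a [^]\<^bsub>F\<^esub> (- P)) \<in> A) \<Longrightarrow>
      weight_kernel X v \<subseteq> A"
proof -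
  have h_closed: "h w \<in> carrier F" "h' w \<in> carrier F" if "w \<in> carrier F" for w
    using h(1,2) that by (auto simp: hom_def)
  have weight': "weight v (h' w) = weight v w" if "w \<in> carrier F" for w
    using weight[OF h_closed(2)[OF that]] h(3)[OF that] by simp
  define L where "L = X \<times> (UNIV :: bool set)"
  have L: "finite L" "\<And>y. y \<in> L \<longleftrightarrow> fst y \<in> X" using X by (auto simp: L_def mem_Times_iff)
  obtain D where D0: "D \<ge> 0" and D: "\<And>w. w \<in> {a, inv\<^bsub>F\<^esub> a} \<union> (\<lambda>y. [y]) ` L \<union>
      (\<lambda>y. h [y]) ` L \<union> (\<lambda>y. h' [y]) ` L \<Longrightarrow> confined v (- D) D w"
    using ex_confined_finite[of "{a, inv\<^bsub>F\<^esub> a} \<union> (\<lambda>y. [y]) ` L \<union> (\<lambda>y. h [y]) ` L \<union> (\<lambda>y. h' [y]) ` L" v]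
      L(1) by blast
  have Da: "confined v (- D) D a" "confined v (- D) D (inv\<^bsub>F\<^esub> a)" by (auto intro: D)
  have D_letter: "\<bar>letter_weight v y\<bar> \<le> D" if "fst y \<in> X" for y
    using D[of "[y]"] that L(2) by auto
  have D_h: "confined v (- D) D (h [y])" "confined v (- D) D (h' [y])" if "fst y \<in> X" for y
  proof -
    have "y \<in> L" using that L(2) by blast
    then show "confined v (- D) D (h [y])" "confined v (- D) D (h' [y])"
      by (blast intro: D)+
  qed
  have letter: "[y] \<in> carrier F" if "fst y \<in> X" for y
    using that letter_in_free_group[of "fst y" X "snd y"] by simp
  \<comment> \<open>a Schreier generator spreads by \<open>2 * D\<close>, its image under \<open>h\<close> or \<open>h'\<close> by \<open>3 * D\<close>; the shift must exceed this,
    and the initial range must contain the conjugating word \<open>a\<^sup>P\<close> and the spread around it\<close>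
  define P where "P = 3 * D + 1"
  define q0 where "q0 = P + 4 * D"
  define Y where "Y = (\<lambda>(k, y). schreier k [y]) ` ({- q0..q0} \<times> L)"
  show ?thesis
  proof (rule that)
    show "finite Y" using L(1) by (simp add: Y_def)
    show "Y \<subseteq> weight_kernel X v"
      using L(2) by (auto simp: Y_def intro!: schreier_weight_kernel letter)
  next
    fix A assume A: "subgroup A F" and YA: "Y \<subseteq> A"
      and iff: "\<And>w. w \<in> weight_kernel X v \<Longrightarrow>
        w \<in> A \<longleftrightarrow> a [^]\<^bsub>F\<^esub> P \<otimes>\<^bsub>F\<^esub> (h w \<otimes>\<^bsub>F\<^esub> a [^]\<^bsub>F\<^esub> (- P)) \<in> A"
    have mem: "\<forall>k (y :: 'x \<times> bool). \<bar>k\<bar> \<le> q0 + int n \<longrightarrow> fst y \<in> X \<longrightarrow> schreier k [y] \<in> A" for n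
    proof (induction n)
      case 0
      have "schreier k [y] \<in> A" if "\<bar>k\<bar> \<le> q0" "fst y \<in> X" for k y
      proof -
        have "(k, y) \<in> {- q0..q0} \<times> L" using that L(2)[of y] by auto
        then have "schreier k [y] \<in> Y" unfolding Y_def by (rule rev_image_eqI) simp
        then show ?thesis using YA by blast
      qed
      then show ?case by simp
    next
      case (Suc n)
      define q where "q = q0 + int n"
      have small: "w \<in> A" if "w \<in> weight_kernel X v" "confined v (- q) q w" for w
        using weight_kernel_mem[OF A _ that] Suc by (simp add: q_def)
      have q: "q \<ge> q0" by (simp add: q_def)
      show ?case
      proof (intro allI impI)
        fix k and y :: "'x \<times> bool"
        assume k: "\<bar>k\<bar> \<le> q0 + int (Suc n)" and y: "fst y \<in> X"
        consider "\<bar>k\<bar> \<le> q" | "k = q + 1" | "k = - q - 1" using k q_def by linarith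
        then show "schreier k [y] \<in> A"
        proof cases
          case 1
          then show ?thesis using Suc.IH y unfolding q_def by blast
        next
          case 2
          let ?w = "h' (schreier (k - P) [y])"
          note y' = letter[OF y]
          have "confined v (min 0 (k - P) - 2 * D - D) (max 0 (k - P) + 2 * D + D) ?w"
            by (rule confined_hom[OF h(2) weight' D_h(2) D0 schreier_closed[OF y']
                  confined_schreier_letter[OF Da y D_letter[OF y]]])
          then have "confined v (- q) q ?w"
            by (rule confined_mono) (use 2 q D0 in \<open>auto simp: P_def q0_def\<close>)
          moreover have wk: "?w \<in> weight_kernel X v"
            using schreier_weight_kernel[OF y', of "k - P"] h_closed weight'
            by (simp add: weight_kernel_def)
          ultimately have "?w \<in> A" by (intro small)
          then have "a [^]\<^bsub>F\<^esub> P \<otimes>\<^bsub>F\<^esub> (h ?w \<otimes>\<^bsub>F\<^esub> a [^]\<^bsub>F\<^esub> (- P)) \<in> A"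
            using iff[OF wk] by blast
          then show ?thesis
            using h(3)[OF schreier_closed[OF y']] schreier_shift[OF y'] by simp
        next
          case 3
          let ?w = "schreier k [y]"
          note y' = letter[OF y]
          have wk: "?w \<in> weight_kernel X v" by (rule schreier_weight_kernel[OF y'])
          have hw: "h ?w \<in> carrier F" "weight v (h ?w) = 0"
            using wk h_closed weight by (auto simp: weight_kernel_def)
          have "confined v (min 0 k - 2 * D - D) (max 0 k + 2 * D + D) (h ?w)"
            by (rule confined_hom[OF h(1) weight D_h(1) D0 schreier_closed[OF y']
                  confined_schreier_letter[OF Da y D_letter[OF y]]])
          then have "confined v (- q - P) (q - P) (h ?w)"
            by (rule confined_mono) (use 3 q D0 in \<open>auto simp: P_def q0_def\<close>)
          moreover have "confined v (- q) q (a [^]\<^bsub>F\<^esub> P)"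
            by (rule confined_mono[OF confined_int_pow[OF Da]]) (use 3 q D0 in \<open>auto simp: P_def q0_def\<close>)
          moreover have "confined v (- q - P) (q - P) (a [^]\<^bsub>F\<^esub> (- P))"
            by (rule confined_mono[OF confined_int_pow[OF Da]]) (use 3 q D0 in \<open>auto simp: P_def q0_def\<close>)
          ultimately have "confined v (- q) q (a [^]\<^bsub>F\<^esub> P \<otimes>\<^bsub>F\<^esub> (h ?w \<otimes>\<^bsub>F\<^esub> a [^]\<^bsub>F\<^esub> (- P)))"
            using hw by (intro confined_mult) auto
          then have "a [^]\<^bsub>F\<^esub> P \<otimes>\<^bsub>F\<^esub> (h ?w \<otimes>\<^bsub>F\<^esub> a [^]\<^bsub>F\<^esub> (- P)) \<in> A"
            using hw a by (intro small) (auto simp: weight_kernel_def)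
          then show ?thesis using iff[OF wk] by blast
        qed
      qed
    qed
    show "weight_kernel X v \<subseteq> A"
    proof
      fix w assume w: "w \<in> weight_kernel X v"
      obtain E where E: "E \<ge> 0" "confined v (- E) E w" using ex_confined by blast
      let ?q = "q0 + int (nat E)"
      have "q0 \<ge> 0" using D0 by (simp add: q0_def P_def)
      then have "confined v (- ?q) ?q w"
        using E by (intro confined_mono[OF E(2)]) auto
      then show "w \<in> A"
        using weight_kernel_mem[OF A _ w] mem by blast
    qed
  qed
qed

end

section \<open>Semidirect products\<close>

lemma semidirect_product_simps:
  "carrier (semidirect_product N H \<phi>) = carrier N \<times> carrier H"
  "(a, x) \<otimes>\<^bsub>semidirect_product N H \<phi>\<^esub> (b, y) = (a \<otimes>\<^bsub>N\<^esub> \<phi> x b, x \<otimes>\<^bsub>H\<^esub> y)"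
  "\<one>\<^bsub>semidirect_product N H \<phi>\<^esub> = (\<one>\<^bsub>N\<^esub>, \<one>\<^bsub>H\<^esub>)"
  by (simp_all add: semidirect_product_def)

lemma snd_mult_semidirect_product:
  "snd (g \<otimes>\<^bsub>semidirect_product N H \<phi>\<^esub> h) = snd g \<otimes>\<^bsub>H\<^esub> snd h"
  by (cases g; cases h) (simp add: semidirect_product_simps)

locale automorphic_action =
  N: group N + H: group H for N (structure) and H (structure) +
  fixes \<phi>
  assumes action: "\<phi> \<in> hom H (AutoGroup N)"
begin

lemma action_auto: "x \<in> carrier H \<Longrightarrow> \<phi> x \<in> auto N"
  using action by (auto simp: hom_def AutoGroup_def)

lemma action_hom: "x \<in> carrier H \<Longrightarrow> \<phi> x \<in> hom N N"
  using action_auto by (auto simp: auto_def)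

lemma action_closed: "x \<in> carrier H \<Longrightarrow> a \<in> carrier N \<Longrightarrow> \<phi> x a \<in> carrier N"
  using action_hom by (auto simp: hom_def)

lemma action_mult:
  assumes "x \<in> carrier H" "y \<in> carrier H" "a \<in> carrier N"
  shows "\<phi> (x \<otimes>\<^bsub>H\<^esub> y) a = \<phi> x (\<phi> y a)"
  using hom_mult[OF action assms(1,2)] action_auto[OF assms(1)] action_auto[OF assms(2)] assms(3)
  by (simp add: AutoGroup_def BijGroup_def auto_def compose_def)

lemma action_one: "a \<in> carrier N \<Longrightarrow> \<phi> \<one>\<^bsub>H\<^esub> a = a"
  using hom_one[OF action H.is_group N.AutoGroup] by (simp add: AutoGroup_def BijGroup_def)

lemma action_unit: "x \<in> carrier H \<Longrightarrow> \<phi> x \<one>\<^bsub>N\<^esub> = \<one>\<^bsub>N\<^esub>"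
  using hom_one[OF action_hom N.is_group N.is_group] .

lemma action_inv:
  assumes "x \<in> carrier H" "a \<in> carrier N"
  shows "\<phi> x (\<phi> (inv\<^bsub>H\<^esub> x) a) = a" "\<phi> (inv\<^bsub>H\<^esub> x) (\<phi> x a) = a"
  using assms action_mult[of x "inv\<^bsub>H\<^esub> x" a] action_mult[of "inv\<^bsub>H\<^esub> x" x a]
  by (simp_all add: action_one)

abbreviation G where "G \<equiv> semidirect_product N H \<phi>"

sublocale G: group G
  by (rule group_semidirect_product[OF N.is_group H.is_group action])

lemma embed_hom: "(\<lambda>a. (a, \<one>\<^bsub>H\<^esub>)) \<in> hom N G"
  by (rule homI) (auto simp: semidirect_product_simps action_one)

text \<open>
  The last part is the invariance under the action: \<open>\<phi> x a\<close> is a conjugate of \<open>a\<close> in the semidirect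
  product.
\<close>

lemma additive_semidirect_product:
  fixes f :: "'a \<times> 'c \<Rightarrow> 'e::ab_group_add"
  assumes f: "\<And>g h. g \<in> carrier G \<Longrightarrow> h \<in> carrier G \<Longrightarrow> f (g \<otimes>\<^bsub>G\<^esub> h) = f g + f h"
  shows "a \<in> carrier N \<Longrightarrow> x \<in> carrier H \<Longrightarrow> f (a, x) = f (a, \<one>\<^bsub>H\<^esub>) + f (\<one>\<^bsub>N\<^esub>, x)"
    and "a \<in> carrier N \<Longrightarrow> b \<in> carrier N \<Longrightarrow>
      f (a \<otimes>\<^bsub>N\<^esub> b, \<one>\<^bsub>H\<^esub>) = f (a, \<one>\<^bsub>H\<^esub>) + f (b, \<one>\<^bsub>H\<^esub>)"
    and "x \<in> carrier H \<Longrightarrow> y \<in> carrier H \<Longrightarrow>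
      f (\<one>\<^bsub>N\<^esub>, x \<otimes>\<^bsub>H\<^esub> y) = f (\<one>\<^bsub>N\<^esub>, x) + f (\<one>\<^bsub>N\<^esub>, y)"
    and "a \<in> carrier N \<Longrightarrow> x \<in> carrier H \<Longrightarrow> f (\<phi> x a, \<one>\<^bsub>H\<^esub>) = f (a, \<one>\<^bsub>H\<^esub>)"
proof -
  show 1: "f (a, x) = f (a, \<one>\<^bsub>H\<^esub>) + f (\<one>\<^bsub>N\<^esub>, x)" if "a \<in> carrier N" "x \<in> carrier H" for a x
    using that f[of "(a, \<one>\<^bsub>H\<^esub>)" "(\<one>\<^bsub>N\<^esub>, x)"]
    by (simp add: semidirect_product_simps action_unit)
  show "f (a \<otimes>\<^bsub>N\<^esub> b, \<one>\<^bsub>H\<^esub>) = f (a, \<one>\<^bsub>H\<^esub>) + f (b, \<one>\<^bsub>H\<^esub>)"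
    if "a \<in> carrier N" "b \<in> carrier N"
    using that f[of "(a, \<one>\<^bsub>H\<^esub>)" "(b, \<one>\<^bsub>H\<^esub>)"]
    by (simp add: semidirect_product_simps action_one)
  show "f (\<one>\<^bsub>N\<^esub>, x \<otimes>\<^bsub>H\<^esub> y) = f (\<one>\<^bsub>N\<^esub>, x) + f (\<one>\<^bsub>N\<^esub>, y)"
    if "x \<in> carrier H" "y \<in> carrier H"
    using that f[of "(\<one>\<^bsub>N\<^esub>, x)" "(\<one>\<^bsub>N\<^esub>, y)"]
    by (simp add: semidirect_product_simps action_unit)
  show "f (\<phi> x a, \<one>\<^bsub>H\<^esub>) = f (a, \<one>\<^bsub>H\<^esub>)" if "a \<in> carrier N" "x \<in> carrier H"
    using that f[of "(\<one>\<^bsub>N\<^esub>, x)" "(a, \<one>\<^bsub>H\<^esub>)"] 1[of "\<phi> x a" x]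
    by (simp add: semidirect_product_simps action_closed)
qed

end

section \<open>First cohomology\<close>

text \<open>
  There are no nonzero coboundaries in degree one, so the elements of \<open>H\<^sup>1\<close> are the singletons of
  cocycles and a spanning family of cocycles is a generating set of the same size.
\<close>

lemma rank_H1_le_card:
  fixes e :: "'i \<Rightarrow> 'g list \<Rightarrow> real"
  assumes I: "finite I" and e: "\<And>i. i \<in> I \<Longrightarrow> e i \<in> cocycles G 1"
    and span: "\<And>f. f \<in> cocycles G 1 \<Longrightarrow> \<exists>c. f = (\<lambda>gs. \<Sum>i\<in>I. c i * e i gs)"
  shows "rank_H1 G \<le> card I"
proof -
  let ?R = "class_ring :: real ring" and ?H = "cohomology G 1"
  interpret V: vectorspace ?R ?H by (rule vectorspace_cohomology_1)
  interpret Z: submodule ?R "cocycles G 1" "cochains G 1" by (rule submodule_cocycles)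
  note H = cohomology_def quotient_module_def coboundaries_1 [unfolded One_nat_def]
  have carrier: "carrier ?H = (\<lambda>f. {f}) ` cocycles G 1"
    by (auto simp: H A_RCOSETS_def' a_r_coset_def' cochains_def simp del: coboundaries.simps)
  have add: "{f} \<oplus>\<^bsub>?H\<^esub> {h} = {\<lambda>gs. f gs + h gs}" for f h
    by (auto simp: H set_add_def' cochains_def simp del: coboundaries.simps)
  have smult: "r \<odot>\<^bsub>?H\<^esub> {f} = {\<lambda>gs. r * f gs}" for r f
    by (auto simp: H a_r_coset_def' cochains_def simp del: coboundaries.simps)
  have zero: "\<zero>\<^bsub>?H\<^esub> = {\<lambda>_. 0}"
    by (simp add: H del: coboundaries.simps)
  define A where "A = (\<lambda>i. {e i}) ` I"
  have A: "finite A" "A \<subseteq> carrier ?H" "card A \<le> card I"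
    using I e unfolding A_def carrier by (blast, blast, intro card_image_le)
  interpret S: submodule ?R "V.span A" ?H by (rule V.span_is_submodule[OF A(2)])
  have sum: "{\<lambda>gs. \<Sum>i\<in>J. c i * e i gs} \<in> V.span A" if "finite J" "J \<subseteq> I" for J and c :: "'i \<Rightarrow> real"
    using that
  proof induction
    case empty
    then show ?case using S.zero_closed unfolding zero by simp
  next
    case (insert i J)
    have "{e i} \<in> V.span A" using V.in_own_span[OF A(2)] insert.prems by (auto simp: A_def)
    then have "c i \<odot>\<^bsub>?H\<^esub> {e i} \<oplus>\<^bsub>?H\<^esub> {\<lambda>gs. \<Sum>i\<in>J. c i * e i gs} \<in> V.span A"
      using insert by (intro S.m_closed S.smult_closed) auto
    then show ?case unfolding smult add using insert.hyps by simp
  qed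
  have "carrier ?H \<subseteq> V.span A"
  proof
    fix C assume "C \<in> carrier ?H"
    then obtain f where "f \<in> cocycles G 1" "C = {f}" unfolding carrier by blast
    then show "C \<in> V.span A" using span sum[OF I order.refl] by blast
  qed
  moreover have "V.span A \<subseteq> carrier ?H" by (rule V.span_is_subset2[OF A(2)])
  ultimately have "V.span A = carrier ?H" by blast
  then have "V.dim \<le> card A"
    unfolding V.dim_def using A by (intro Least_le) blast
  then show ?thesis using A(3) by (simp add: rank_H1_def)
qed

text \<open>
  A cocycle that vanishes on the kernel factors through the free quotient, where it is a
  combination of the exponent sums of the \<open>n\<close> generators.
\<close>

lemma rank_H1_free_quotient:
  fixes n :: nat
  assumes "group N" and \<phi>: "\<phi> \<in> hom (free_group_rank n) (AutoGroup N)"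
    and triv: "\<And>f a. f \<in> cocycles (semidirect_product N (free_group_rank n) \<phi>) 1 \<Longrightarrow>
      a \<in> carrier N \<Longrightarrow> f [(a, [])] = 0"
  shows "rank_H1 (semidirect_product N (free_group_rank n) \<phi>) \<le> n"
proof -
  let ?F = "free_group_rank n" and ?G = "semidirect_product N (free_group_rank n) \<phi>"
  interpret automorphic_action N ?F \<phi>
    by (intro automorphic_action.intro automorphic_action_axioms.intro assms group_free_group)
  define e :: "nat \<Rightarrow> ('a \<times> (nat \<times> bool) list) list \<Rightarrow> real" where
    "e i gs = (if gs \<in> tuples ?G 1 then weight (\<lambda>k. of_bool (k = i)) (snd (hd gs)) else 0)" for i gs
  have tuples: "gs \<in> tuples ?G 1 \<longleftrightarrow> (\<exists>g\<in>carrier ?G. gs = [g])" for gs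
    by (auto simp: tuples_def length_Suc_conv)
  note tuples' = tuples[unfolded One_nat_def]
  have "e i \<in> cocycles ?G 1" for i
  proof -
    have "e i \<in> carrier (cochains ?G 1)" by (simp add: e_def cochains_def)
    moreover have "e i [g \<otimes>\<^bsub>?G\<^esub> h] = e i [g] + e i [h]" if "g \<in> carrier ?G" "h \<in> carrier ?G" for g h
      using that by (auto simp: e_def tuples' snd_mult_semidirect_product)
    ultimately show ?thesis using cocycles_1[of "e i" ?G] by blast
  qed
  moreover have "\<exists>c. f = (\<lambda>gs. \<Sum>i<n. c i * e i gs)" if f: "f \<in> cocycles ?G 1" for f
  proof -
    have fc: "f \<in> carrier (cochains ?G 1)" using f by (simp add: cocycles_def)
    have add: "f [g \<otimes>\<^bsub>?G\<^esub> h] = f [g] + f [h]" if "g \<in> carrier ?G" "h \<in> carrier ?G" for g h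
      using f cocycles_1[OF fc] that by blast
    define c where "c i = f [(\<one>\<^bsub>N\<^esub>, [(i, True)])]" for i
    have w: "f [(\<one>\<^bsub>N\<^esub>, w)] = weight c w" if "w \<in> carrier ?F" for w
      unfolding c_def
      by (rule additive_eq_weight[OF _ that, of "\<lambda>w. f [(\<one>\<^bsub>N\<^esub>, w)]"])
        (rule additive_semidirect_product(3)[of "\<lambda>g. f [g]"], use add in auto)
    have sum: "weight c w = (\<Sum>i<n. c i * weight (\<lambda>k. of_bool (k = i)) w)"
      if "fst ` set w \<subseteq> {..<n}" for w
      using that
    proof (induction w)
      case (Cons a w)
      have "letter_weight c a = (\<Sum>i<n. c i * letter_weight (\<lambda>k. of_bool (k = i)) a)"
        using Cons.prems by (cases a) (auto simp: letter_weight_def sum_negf of_bool_def if_distrib cong: if_cong)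
      then show ?case using Cons by (simp add: sum.distrib distrib_left)
    qed simp
    have "f gs = (\<Sum>i<n. c i * e i gs)" for gs
    proof (cases "gs \<in> tuples ?G 1")
      case True
      then obtain a w where gs: "gs = [(a, w)]" "a \<in> carrier N" "w \<in> carrier ?F"
        by (auto simp: tuples' semidirect_product_simps)
      have "f [(a, w)] = f [(a, [])] + f [(\<one>\<^bsub>N\<^esub>, w)]"
        using additive_semidirect_product(1)[of "\<lambda>g. f [g]", OF add gs(2,3)] by (simp add: one_free_group)
      also have "\<dots> = (\<Sum>i<n. c i * weight (\<lambda>k. of_bool (k = i)) w)"
        using triv[OF f gs(2)] w[OF gs(3)] sum gs(3) by (simp add: carrier_free_group)
      finally show ?thesis using True gs by (simp add: e_def)
    next
      case False
      then show ?thesis using fc unfolding e_def cochains_def by simp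
    qed
    then show ?thesis by blast
  qed
  ultimately show ?thesis
    using rank_H1_le_card[of "{..<n}" e ?G] by simp
qed

section \<open>Integral weights\<close>

text \<open>
  The real numbers are a vector space over \<open>\<rat>\<close>, and \<open>r\<close> can be completed to a basis.
\<close>

lemma ex_rational_functional:
  fixes r :: real
  assumes "r \<noteq> 0"
  obtains L :: "real \<Rightarrow> rat" where "\<And>x y. L (x + y) = L x + L y" "L r \<noteq> 0"
proof -
  interpret Q: vector_space_pair "\<lambda>(q::rat) (x::real). of_rat q * x" "\<lambda>(q::rat) (x::rat). q * x"
    by unfold_locales (auto simp: algebra_simps of_rat_add of_rat_mult)
  have ind: "Q.vs1.independent {r}"
    using assms by simp
  let ?L = "Q.construct {r} (\<lambda>_. 1)"
  have "Vector_Spaces.linear (\<lambda>q x. of_rat q * x) (*) ?L"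
    by (rule Q.linear_construct[OF ind])
  then have "?L (x + y) = ?L x + ?L y" for x y
    by (rule Vector_Spaces.linear.axioms(3)[THEN module_hom.add])
  moreover have "?L r = 1" by (rule Q.construct_basis[OF ind]) simp
  ultimately show ?thesis using that[of ?L] by simp
qed

lemma additive_weight:
  fixes L :: "'a::ab_group_add \<Rightarrow> 'b::ab_group_add"
  assumes L: "\<And>x y. L (x + y) = L x + L y"
  shows "L (weight v w) = weight (\<lambda>i. L (v i)) w"
proof -
  have zero: "L 0 = 0" using L[of 0 0] by simp
  have "L (- x) = - L x" for x using L[of x "- x"] zero by (simp add: eq_neg_iff_add_eq_0 add.commute)
  then have "L (letter_weight v a) = letter_weight (\<lambda>i. L (v i)) a" for a
    by (simp add: letter_weight_def)
  then show ?thesis by (induction w) (simp_all add: L zero)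
qed

lemma weight_cong:
  assumes "\<And>i. i \<in> X \<Longrightarrow> u i = v i" "w \<in> carrier (free_group X)"
  shows "weight u w = weight v w"
proof -
  have "fst ` set w \<subseteq> X" using assms(2) by (simp add: carrier_free_group)
  then show ?thesis by (induction w) (auto simp: letter_weight_def assms(1))
qed

lemma ex_common_denominator:
  fixes q :: "'x \<Rightarrow> rat"
  assumes "finite X"
  shows "\<exists>d::int. d > 0 \<and> (\<forall>i\<in>X. of_int d * q i \<in> \<int>)"
  using assms
proof induction
  case (insert j X)
  then obtain d :: int where d: "d > 0" "\<forall>i\<in>X. of_int d * q i \<in> \<int>" by blast
  obtain a b where ab: "quotient_of (q j) = (a, b)" by force
  then have b: "b > 0" "q j = of_int a / of_int b"
    using quotient_of_denom_pos quotient_of_div by blast+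
  have "of_int (d * b) * q i \<in> \<int>" if "i \<in> insert j X" for i
  proof (cases "i = j")
    case True
    then have "of_int (d * b) * q i = of_int (d * a)" using b by simp
    then show ?thesis by (simp only: Ints_of_int)
  next
    case False
    then have "i \<in> X" using that by simp
    then have "of_int b * (of_int d * q i) \<in> \<int>"
      by (intro Ints_mult[OF Ints_of_int] bspec[OF d(2)])
    then show ?thesis by (simp add: ac_simps)
  qed
  then show ?case using d(1) b(1) by (intro exI[of _ "d * b"]) auto
qed (auto intro: exI[of _ 1])

text \<open>
  A real weight takes its values in a finitely generated subgroup of the reals.  A \<open>\<rat>\<close>-linear
  functional makes them rational, a common denominator makes them integral, and both steps respect
  coincidences of weights, which is how invariance is inherited.
\<close>

lemma ex_integral_weight:
  fixes g :: "'x \<Rightarrow> real"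
  assumes X: "finite X" and a: "a \<in> carrier (free_group X)" "weight g a \<noteq> 0"
  obtains v :: "'x \<Rightarrow> int" where "weight v a \<noteq> 0"
    "\<And>u w. u \<in> carrier (free_group X) \<Longrightarrow> w \<in> carrier (free_group X) \<Longrightarrow>
      weight g u = weight g w \<Longrightarrow> weight v u = weight v w"
proof -
  obtain L :: "real \<Rightarrow> rat" where L: "\<And>x y. L (x + y) = L x + L y" "L (weight g a) \<noteq> 0"
    using ex_rational_functional[OF a(2)] by blast
  obtain d :: int where d: "d > 0" "\<forall>i\<in>X. of_int d * L (g i) \<in> \<int>"
    using ex_common_denominator[OF X, of "\<lambda>i. L (g i)"] by blast
  define v where "v i = \<lfloor>of_int d * L (g i)\<rfloor>" for i
  have v: "rat_of_int (weight v w) = of_int d * L (weight g w)" if "w \<in> carrier (free_group X)" for w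
  proof -
    have "rat_of_int (weight v w) = weight (\<lambda>i. rat_of_int (v i)) w"
      by (rule additive_weight) simp
    also have "\<dots> = weight (\<lambda>i. of_int d * L (g i)) w"
      by (rule weight_cong[OF _ that]) (use d(2) in \<open>auto simp: v_def\<close>)
    also have "\<dots> = of_int d * L (weight g w)"
      by (rule additive_weight[symmetric]) (simp add: L(1) distrib_left)
    finally show ?thesis .
  qed
  show ?thesis
  proof (rule that[of v])
    show "weight v a \<noteq> 0" using v[OF a(1)] L(2) d(1) by auto
    show "weight v u = weight v w"
      if "u \<in> carrier (free_group X)" "w \<in> carrier (free_group X)" "weight g u = weight g w" for u w
      using v[OF that(1)] v[OF that(2)] that(3) by (simp flip: of_int_eq_iff[where 'a = rat])
  qed
qed

text \<open>
  The weights of all words form a subgroup of \<open>\<int>\<close>; dividing by its least positive element makes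
  the weight surjective.
\<close>

lemma ex_unit_weight:
  fixes v :: "'x \<Rightarrow> int"
  assumes a: "a \<in> carrier (free_group X)" "weight v a \<noteq> 0"
  obtains u b and d :: int where "d \<noteq> 0" "\<And>w. w \<in> carrier (free_group X) \<Longrightarrow> weight v w = d * weight u w"
    "b \<in> carrier (free_group X)" "weight u b = 1"
proof -
  let ?F = "free_group X"
  interpret group ?F by (rule group_free_group)
  define P where "P k \<longleftrightarrow> k > 0 \<and> (\<exists>w\<in>carrier ?F. weight v w = int k)" for k
  have "P (nat \<bar>weight v a\<bar>)"
    using a by (auto simp: P_def abs_if intro: bexI[of _ "inv\<^bsub>?F\<^esub> a"])
  define k where "k = (LEAST k. P k)"
  have "P k" and least: "\<And>j. P j \<Longrightarrow> k \<le> j"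
    using \<open>P (nat _)\<close> unfolding k_def by (auto intro: LeastI Least_le)
  then obtain b where b: "k > 0" "b \<in> carrier ?F" "weight v b = int k" by (auto simp: P_def)
  have dvd: "int k dvd weight v w" if w: "w \<in> carrier ?F" for w
  proof -
    let ?r = "weight v w mod int k"
    have "weight v (w \<otimes>\<^bsub>?F\<^esub> b [^]\<^bsub>?F\<^esub> (- (weight v w div int k))) = ?r"
      using b by (simp add: weight_int_pow minus_div_mult_eq_mod[symmetric])
    moreover have "w \<otimes>\<^bsub>?F\<^esub> b [^]\<^bsub>?F\<^esub> (- (weight v w div int k)) \<in> carrier ?F"
      using w b by simp
    moreover have "?r \<ge> 0" "?r < int k" using b by simp_all
    ultimately have "?r > 0 \<Longrightarrow> P (nat ?r)"
      unfolding P_def by (intro conjI bexI[of _ "w \<otimes>\<^bsub>?F\<^esub> b [^]\<^bsub>?F\<^esub> (- (weight v w div int k))"]) simp_all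
    then have "\<not> ?r > 0" using least[of "nat ?r"] \<open>?r < int k\<close> by auto
    then show ?thesis using \<open>?r \<ge> 0\<close> by (simp add: dvd_eq_mod_eq_0)
  qed
  define u where "u i = v i div int k" for i
  have eq: "weight v w = int k * weight u w" if w: "w \<in> carrier ?F" for w
  proof -
    have "int k * u i = v i" if "i \<in> X" for i
      using dvd[OF letter_in_free_group[OF that, of True]] by (simp add: u_def letter_weight_def)
    then have "weight (\<lambda>i. int k * u i) w = weight v w"
      by (rule weight_cong[OF _ w])
    moreover have "int k * weight u w = weight (\<lambda>i. int k * u i) w"
      by (rule additive_weight) (simp add: distrib_left)
    ultimately show ?thesis by simp
  qed
  show ?thesis
  proof (rule that[of "int k" u b])
    show "weight u b = 1" using eq[OF b(2)] b by simp
  qed (use b eq in auto)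
qed

section \<open>Incoherence of free-by-free groups with excess cohomology\<close>

lemma (in automorphic_action) kernel_subgroup:
  fixes f :: "'a \<times> 'c \<Rightarrow> int"
  assumes f: "\<And>g h. g \<in> carrier G \<Longrightarrow> h \<in> carrier G \<Longrightarrow> f (g \<otimes>\<^bsub>G\<^esub> h) = f g + f h"
  shows "subgroup {g \<in> carrier G. f g = 0} G"
proof -
  have one: "f \<one>\<^bsub>G\<^esub> = 0" using f[OF G.one_closed G.one_closed] by simp
  have inv: "f (inv\<^bsub>G\<^esub> g) = - f g" if "g \<in> carrier G" for g
    using f[of "inv\<^bsub>G\<^esub> g" g] that one by simp
  show ?thesis
  proof (rule G.subgroupI)
    show "{g \<in> carrier G. f g = 0} \<noteq> {}" using one G.one_closed by blast
  qed (use f inv in auto)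
qed

theorem corollary4p8:
  fixes m n :: nat
    and \<phi> :: "(nat \<times> bool) list \<Rightarrow> (nat \<times> bool) list \<Rightarrow> (nat \<times> bool) list"
    and G :: "((nat \<times> bool) list \<times> (nat \<times> bool) list) monoid"
  assumes "m \<ge> 2" and "n \<ge> 2"
    and "\<phi> \<in> hom (free_group_rank n) (AutoGroup (free_group_rank m))"
    and "G = semidirect_product (free_group_rank m) (free_group_rank n) \<phi>"
    and "rank_H1 G \<ge> n + 1"
  shows "incoherent G"
proof -
  let ?N = "free_group_rank m" and ?H = "free_group_rank n"
  interpret automorphic_action ?N ?H \<phi>
    by (intro automorphic_action.intro automorphic_action_axioms.intro assms group_free_group)
  note G_eq = assms(4)
  have G: "semidirect_product ?N ?H \<phi> = G" by (simp add: G_eq)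
  note simps = semidirect_product_simps[of ?N ?H \<phi>, unfolded G]
  interpret GG: group G using G.is_group by (simp only: G)

  \<comment> \<open>an excess class in \<open>H\<^sup>1\<close>, turned into an invariant surjective integral weight \<open>v\<close>\<close>
  obtain f x where f: "f \<in> cocycles G 1" and x: "x \<in> carrier ?N" "f [(x, [])] \<noteq> 0"
  proof (rule ccontr)
    assume "\<not> thesis"
    then have "rank_H1 G \<le> n"
      using rank_H1_free_quotient[OF group_free_group assms(3)] that unfolding G by blast
    then show False using assms(5) by simp
  qed
  have f_add: "f [g \<otimes>\<^bsub>G\<^esub> h] = f [g] + f [h]" if "g \<in> carrier G" "h \<in> carrier G" for g h
    using f cocycles_1[of f G] that by (auto simp: cocycles_def)
  define g where "g i = f [([(i, True)], [])]" for i
  have g: "f [(w, [])] = weight g w" if "w \<in> carrier ?N" for w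
    unfolding g_def
    by (rule additive_eq_weight[OF _ that, of "\<lambda>w. f [(w, [])]"])
      (rule additive_semidirect_product(2)[of "\<lambda>g. f [g]", unfolded G one_free_group], use f_add in auto)
  have g_inv: "weight g (\<phi> y w) = weight g w" if "w \<in> carrier ?N" "y \<in> carrier ?H" for y w
    using additive_semidirect_product(4)[of "\<lambda>g. f [g]" w y, unfolded G one_free_group] f_add that
    by (simp add: g action_closed)
  obtain v0 :: "nat \<Rightarrow> int" where v0: "weight v0 x \<noteq> 0"
    "\<And>u w. u \<in> carrier ?N \<Longrightarrow> w \<in> carrier ?N \<Longrightarrow> weight g u = weight g w \<Longrightarrow> weight v0 u = weight v0 w"
    using ex_integral_weight[OF finite_lessThan x(1), of g] g[OF x(1)] x(2) by metis
  obtain v a and d :: int where d: "d \<noteq> 0" "\<And>w. w \<in> carrier ?N \<Longrightarrow> weight v0 w = d * weight v w"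
    and a: "a \<in> carrier ?N" "weight v a = 1"
    using ex_unit_weight[OF x(1) v0(1)] by metis
  have v_inv: "weight v (\<phi> y w) = weight v w" if "w \<in> carrier ?N" "y \<in> carrier ?H" for y w
    using v0(2)[OF action_closed[OF that(2,1)] that(1) g_inv[OF that]] d that
    by (simp add: action_closed)

  interpret U: unit_weight "{..<m}" v a by unfold_locales (rule a)+
  let ?t = "\<lambda>i. [(i, True)] :: (nat \<times> bool) list"
  have t: "?t i \<in> carrier ?H" if "i < n" for i
    using that by (simp add: letter_in_free_group)
  have t0: "?t 0 \<in> carrier ?H" using assms(2) by (intro t) simp
  obtain P :: int and Y where Y: "finite Y" "Y \<subseteq> weight_kernel {..<m} v"
    and gen: "\<And>A. subgroup A ?N \<Longrightarrow> Y \<subseteq> A \<Longrightarrow>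
      (\<And>w. w \<in> weight_kernel {..<m} v \<Longrightarrow>
        w \<in> A \<longleftrightarrow> a [^]\<^bsub>?N\<^esub> P \<otimes>\<^bsub>?N\<^esub> (\<phi> (?t 0) w \<otimes>\<^bsub>?N\<^esub> a [^]\<^bsub>?N\<^esub> (- P)) \<in> A) \<Longrightarrow>
      weight_kernel {..<m} v \<subseteq> A"
  proof (rule U.weight_kernel_twisted_generators[of "\<phi> (?t 0)" "\<phi> (inv\<^bsub>?H\<^esub> ?t 0)"])
    show "\<phi> (?t 0) \<in> hom ?N ?N" "\<phi> (inv\<^bsub>?H\<^esub> ?t 0) \<in> hom ?N ?N"
      using t0 by (auto intro: action_hom)
  qed (use t0 v_inv action_inv(1) in auto)

  \<comment> \<open>the new complement is generated by \<open>s i = (a\<^sup>P, t\<^sub>i)\<close>; \<open>F\<close> extends \<open>v\<close> and vanishes on each \<open>s i\<close>\<close>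
  define b where "b = a [^]\<^bsub>?N\<^esub> P"
  have b: "b \<in> carrier ?N" "weight v b = P" by (simp_all add: b_def a U.weight_pow)
  define F where "F = (\<lambda>(w, y :: (nat \<times> bool) list). weight v w - P * weight (\<lambda>_. 1) y)"
  have F: "F (g \<otimes>\<^bsub>G\<^esub> h) = F g + F h" if "g \<in> carrier G" "h \<in> carrier G" for g h
    using that v_inv by (auto simp: F_def simps algebra_simps)
  define K where "K = {g \<in> carrier G. F g = 0}"
  have K: "subgroup K G"
    using kernel_subgroup[of F] F unfolding K_def G by blast
  interpret K: subgroup K G by (rule K)
  let ?K = "G\<lparr>carrier := K\<rparr>"
  have group_K: "group ?K" by (rule K.subgroup_is_group) (rule GG.is_group)
  interpret KK: group ?K by (rule group_K)

  define s where "s i = (b, ?t i)" for i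
  have s: "s i \<in> K" if "i < n" for i
    using that b t by (simp add: K_def s_def F_def simps letter_weight_def)
  have s_Pi: "s \<in> {..<n} \<rightarrow> carrier ?K" using s by auto
  define \<sigma> where "\<sigma> = word_image ?K s"
  have \<sigma>: "\<sigma> \<in> hom ?H ?K" unfolding \<sigma>_def by (rule KK.word_image_hom[OF s_Pi])
  have \<sigma>_t: "\<sigma> (?t i) = s i" if "i < n" for i
    unfolding \<sigma>_def by (rule KK.word_image_letter[OF s_Pi]) (use that in simp)
  have snd_hom: "snd \<in> hom ?K ?H"
    by (rule homI) (use K.subset in \<open>auto simp: simps snd_mult_semidirect_product[of ?N ?H \<phi>, unfolded G]\<close>)
  have snd_\<sigma>: "snd (\<sigma> w) = w" if "w \<in> carrier ?H" for w
  proof -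
    have "(snd \<circ> \<sigma>) w = id w"
      by (rule H.hom_free_group_eq[OF Group.hom_compose[OF \<sigma> snd_hom] _ _ that])
        (auto simp: hom_def \<sigma>_t s_def)
    then show ?thesis by simp
  qed
  let ?\<iota> = "\<lambda>w. (w, [] :: (nat \<times> bool) list)"
  have \<iota>: "group_hom ?N G ?\<iota>"
    using embed_hom GG.is_group N.is_group
    by (simp add: group_hom_def group_hom_axioms_def G one_free_group)
  interpret \<iota>: group_hom ?N G ?\<iota> by (rule \<iota>)
  \<comment> \<open>the projection to \<open>F\<^sub>n\<close> splits over \<open>K\<close>, and its kernel is the kernel of the weight\<close>
  have ker: "kernel ?K ?H snd = ?\<iota> ` weight_kernel {..<m} v"
    using H.one_closed
    by (auto simp: kernel_def K_def simps F_def weight_kernel_def one_free_group)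

  define S where "S = insert (s 0) (?\<iota> ` Y)"
  have SK: "S \<subseteq> K"
  proof -
    have "?\<iota> ` Y \<subseteq> K" using ker Y(2) by (force simp: kernel_def)
    then show ?thesis using s assms(2) by (simp add: S_def)
  qed
  have sub_gen: "subgroup (generate G S) G"
    using SK K.subset by (intro GG.generate_is_subgroup) blast
  have ker_gen: "kernel ?K ?H snd \<subseteq> generate G S"
  proof -
    interpret A: subgroup "generate G S" G by (rule sub_gen)
    \<comment> \<open>the part of \<open>N\<close> already generated; it is stable under conjugation by \<open>s 0\<close> in both directions\<close>
    define A where "A = {w \<in> carrier ?N. ?\<iota> w \<in> generate G S}"
    have s0: "s 0 \<in> generate G S" by (rule generate.incl) (simp add: S_def)
    have s0c: "s 0 \<in> carrier G" using s0 by (rule A.mem_carrier)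
    have "weight_kernel {..<m} v \<subseteq> A"
    proof (rule gen)
      show "subgroup A ?N"
      proof (rule N.subgroupI)
        show "A \<noteq> {}" using A.one_closed \<iota>.hom_one by (force simp: A_def simps one_free_group)
      next
        fix w assume "w \<in> A"
        then show "inv\<^bsub>?N\<^esub> w \<in> A"
          using A.m_inv_closed[of "?\<iota> w"] by (auto simp: A_def)
      next
        fix w u assume "w \<in> A" "u \<in> A"
        then show "w \<otimes>\<^bsub>?N\<^esub> u \<in> A"
          using A.m_closed[of "?\<iota> w" "?\<iota> u"] by (auto simp: A_def)
      qed (auto simp: A_def)
      show "Y \<subseteq> A"
        using Y(2) by (auto simp: A_def S_def weight_kernel_def intro: generate.incl)
    next
      fix w assume "w \<in> weight_kernel {..<m} v"
      then have w: "w \<in> carrier ?N" by (simp add: weight_kernel_def)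
      let ?w = "b \<otimes>\<^bsub>?N\<^esub> (\<phi> (?t 0) w \<otimes>\<^bsub>?N\<^esub> inv\<^bsub>?N\<^esub> b)"
      have w': "?w \<in> carrier ?N" using w b t0 by (simp add: action_closed)
      \<comment> \<open>conjugation by \<open>s 0\<close> is the action of \<open>t\<^sub>0\<close> followed by conjugation by \<open>a\<^sup>P\<close>\<close>
      have "s 0 \<otimes>\<^bsub>G\<^esub> ?\<iota> w = ?\<iota> ?w \<otimes>\<^bsub>G\<^esub> s 0"
        using w b t0 action_closed[OF t0 w] action_one
        by (simp add: s_def simps N.m_assoc flip: one_free_group[of "{..<n}"])
      then have "?\<iota> w \<in> generate G S \<longleftrightarrow> ?\<iota> ?w \<in> generate G S"
        using s0 s0c w w' \<iota>.hom_closed A.m_closed A.m_inv_closed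
        by (metis GG.inv_solve_left GG.inv_solve_right GG.m_closed)
      then have "w \<in> A \<longleftrightarrow> ?w \<in> A" using w w' by (simp add: A_def)
      then show "w \<in> A \<longleftrightarrow> a [^]\<^bsub>?N\<^esub> P \<otimes>\<^bsub>?N\<^esub> (\<phi> (?t 0) w \<otimes>\<^bsub>?N\<^esub> a [^]\<^bsub>?N\<^esub> (- P)) \<in> A"
        using a by (simp add: b_def N.int_pow_neg)
    qed
    then show ?thesis by (auto simp: ker A_def)
  qed

  have "\<not> finitely_presented ?K"
  proof (rule split_extension_not_finitely_presented[OF group_K snd_hom \<sigma> snd_\<sigma>, of 0 1])
    show "0 \<in> {..<n}" "1 \<in> {..<n}" "(0::nat) \<noteq> 1" using assms(2) by auto
    show "kernel ?K ?H snd = kernel ?K ?H snd" ..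
    show "finite (?\<iota> ` Y)" using Y(1) by simp
    show "?\<iota> ` Y \<subseteq> kernel ?K ?H snd" using Y(2) ker by blast
    show "kernel ?K ?H snd \<subseteq> generate ?K (insert (\<sigma> [(0, True)]) (?\<iota> ` Y))"
      using ker_gen \<sigma>_t[of 0] assms(2) GG.generate_consistent[OF SK K] by (simp add: S_def)
  next
    fix Z assume Z: "finite Z" "Z \<subseteq> kernel ?K ?H snd"
    define X where "X = fst ` Z"
    have Z': "Z \<subseteq> ?\<iota> ` weight_kernel {..<m} v" using Z(2) by (simp only: ker)
    have ZX: "Z = ?\<iota> ` X"
    proof -
      have "?\<iota> (fst z) = z" if "z \<in> Z" for z
        using that Z' by auto
      then show ?thesis by (simp add: X_def image_image)
    qed
    have X: "finite X" "X \<subseteq> weight_kernel {..<m} v"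
      using Z(1) Z' by (auto simp: X_def)
    have XN: "X \<subseteq> carrier ?N" using X(2) by (auto simp: weight_kernel_def)
    have "generate ?K Z = generate G Z"
      by (rule GG.generate_consistent[OF _ K]) (use Z in \<open>auto simp: kernel_def\<close>)
    also have "\<dots> = ?\<iota> ` generate ?N X"
      unfolding ZX using \<iota>.generate_img[OF XN] by simp
    finally have gen_Z: "generate ?K Z = ?\<iota> ` generate ?N X" .
    obtain i where i: "i < m" "v i \<noteq> 0"
    proof -
      have "\<exists>i<m. v i \<noteq> 0"
      proof (rule ccontr)
        assume "\<not> ?thesis"
        then have "weight v a = weight (\<lambda>_. 0) a" by (intro weight_cong[OF _ a(1)]) auto
        moreover have "weight (\<lambda>_. 0 :: int) w = 0" for w :: "(nat \<times> bool) list"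
          by (induction w) (auto simp: letter_weight_def)
        ultimately show False using a(2) by simp
      qed
      then show ?thesis using that by blast
    qed
    obtain j where j: "j < m" "j \<noteq> i"
      using that[of "if i = 0 then 1 else 0"] assms(1) by (auto split: if_splits)
    have "generate ?N X \<noteq> weight_kernel {..<m} v"
      using weight_kernel_not_finitely_generated[of i "{..<m}" j v X] i j X by auto
    then show "generate ?K Z \<noteq> kernel ?K ?H snd"
      unfolding gen_Z ker by (simp add: inj_image_eq_iff inj_on_def)
  qed
  moreover have "finitely_generated ?K"
  proof -
    define T where "T = S \<union> s ` {..<n}"
    have T: "finite T" "T \<subseteq> K" using Y(1) SK s by (auto simp: T_def S_def)
    have "generate ?K T = carrier ?K"
    proof
      show "generate ?K T \<subseteq> carrier ?K" by (rule KK.generate_incl) (use T in simp)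
      interpret T: subgroup "generate ?K T" ?K
        by (rule KK.generate_is_subgroup) (use T in simp)
      have \<sigma>_gen: "\<sigma> w \<in> generate ?K T" if "w \<in> carrier ?H" for w
        using that
      proof (induction w rule: free_group_induct)
        case one
        then show ?case by (simp add: \<sigma>_def generate.one[of ?K T, simplified])
      next
        case (mult y w)
        have "s (fst y) \<in> generate ?K T"
          using mult.hyps(1) by (intro generate.incl) (simp add: T_def)
        then have "letter_image ?K s y \<in> generate ?K T"
          using T.m_inv_closed by (simp add: letter_image_def)
        then show ?case
          using mult.IH T.m_closed by (simp add: \<sigma>_def)
      qed
      show "carrier ?K \<subseteq> generate ?K T"
      proof
        fix g assume g: "g \<in> carrier ?K"
        have sg: "snd g \<in> carrier ?H" using snd_hom g by (rule hom_in_carrier)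
        have \<sigma>g: "\<sigma> (snd g) \<in> carrier ?K" using \<sigma> sg by (rule hom_in_carrier)
        let ?k = "g \<otimes>\<^bsub>?K\<^esub> inv\<^bsub>?K\<^esub> \<sigma> (snd g)"
        interpret snd: group_hom ?K ?H snd
          by (simp add: group_hom_def group_hom_axioms_def snd_hom group_K H.is_group)
        have k: "?k \<in> carrier ?K" using KK.m_closed[OF g KK.inv_closed[OF \<sigma>g]] .
        have "snd ?k = snd g \<otimes>\<^bsub>?H\<^esub> inv\<^bsub>?H\<^esub> snd (\<sigma> (snd g))"
          using snd.hom_mult[OF g KK.inv_closed[OF \<sigma>g]] snd.hom_inv[OF \<sigma>g] by (simp only:)
        also have "\<dots> = \<one>\<^bsub>?H\<^esub>" unfolding snd_\<sigma>[OF sg] by (rule H.r_inv[OF sg])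
        finally have "?k \<in> kernel ?K ?H snd" using k unfolding kernel_def by blast
        then have "?k \<in> generate G S" using ker_gen by blast
        also have "\<dots> = generate ?K S" by (rule GG.generate_consistent[OF SK K, symmetric])
        also have "\<dots> \<subseteq> generate ?K T" by (rule KK.mono_generate) (simp add: T_def)
        finally have "?k \<otimes>\<^bsub>?K\<^esub> \<sigma> (snd g) \<in> generate ?K T"
          using \<sigma>_gen[OF sg] by (rule generate.eng)
        also have "?k \<otimes>\<^bsub>?K\<^esub> \<sigma> (snd g) = g"
          using g \<sigma>g by (simp only: KK.m_assoc KK.inv_closed KK.l_inv KK.r_one)
        finally show "g \<in> generate ?K T" .
      qed
    qed
    then show ?thesis
      using T unfolding finitely_generated_def by (intro exI[of _ T]) simp
  qed
  ultimately show ?thesis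
    using K by (auto simp: coherent_def)
qed

end
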